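(* Let $0<\beta<1$ and let $0=t_0<t_1<\cdots<t_N=T$ be a time mesh with step sizes $\tau_k=t_k-t_{k-1}$ and step ratios $r_k=\tau_k/\tau_{k-1}$ $(2\le k\le N)$. Suppose that $$r_{k+1}\ \ge\ r_*(r_k):=\left[\frac{(2^\beta-1)\rho(r_k)}{\rho(2r_k)-\rho(r_k)}\right]^{\frac1{1-\beta}}\qquad\text{for } 2\le k\le N-1,\qquad \rho(z):=(z+1)^{1+\beta}-z^{1+\beta}-1 .$$ Let $a^{(\beta,n)}_{n-k}$ be the integral averaged kernels, and let $\mathsf a^{(\beta,n)}_{n-k}$, $\mathsf p^{(\beta,n)}_{n-k}$ and ${}^{r}\mathsf p^{(\beta,n)}_{n-k}$ be the modified kernels and their DCC and RCC kernels, all as defined in the context. Then $\mathsf p^{(\beta,n)}_{n-k}>0$ and ${}^{r}\mathsf p^{(\beta,n)}_{n-k}>0$ for $1\le k\le n\le N$, and for every real sequence $\{w_k\}_{k=1}^N$, with $v_0:=0$ and $v_j:=\sum_{\ell=1}^{j}\mathsf a^{(\beta,j)}_{j-\ell}w_\ell$, the following discrete gradient structure holds for every $1\le n\le N$: $$2w_n\sum_{j=1}^n a^{(\beta,n)}_{n-j}w_j=\sum_{j=1}^{n}\mathsf p_{n-j}^{(\beta,n)}v_j^2-\sum_{j=1}^{n-1}\mathsf p_{n-1-j}^{(\beta,n-1)}v_j^2+\sum_{j=1}^{n-1}\left(\frac{1}{{}^{r}\mathsf p_{n-j}^{(\beta,n)}}-\frac{1}{{}^{r}\mathsf p_{n-j-1}^{(\beta,n)}}\right)\left(\sum_{k=1}^{j}{}^{r}\mathsf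 p_{n-k}^{(\beta,n)}(v_k-v_{k-1})\right)^2 .$$ Moreover, the kernels $a^{(\beta,n)}_{n-k}$ are positive definite in the sense that, for every $1\le n\le N$, $$2\sum_{k=1}^n w_k\sum_{j=1}^k a^{(\beta,k)}_{k-j}w_j\ \ge\ \sum_{k=1}^{n}\mathsf p_{n-k}^{(\beta,n)}v_k^2\ >\ 0\qquad\text{whenever } \{w_k\}_{k=1}^n \text{ is not identically zero.}$$
   Context: $\omega_\beta(t):=t^{\beta-1}/\Gamma(\beta)$ for $t>0$. The integral averaged kernels are, for $1\le k\le n\le N$, $$a_{n-k}^{(\beta,n)}:=\frac{1}{\tau_n\tau_{k}}\int_{t_{n-1}}^{t_n}\int_{t_{k-1}}^{\min\{t,t_k\}}\omega_{\beta}(t-s)\,ds\,dt .$$ The modified kernels are $\mathsf a_{0}^{(\beta,n)}:=2a_{0}^{(\beta,n)}$ and $\mathsf a_{n-j}^{(\beta,n)}:=a_{n-j}^{(\beta,n)}$ for $1\le j\le n-1$. For any triangular array $\{a_{n-k}^{(n)}\}_{1\le k\le n}$ with $a_0^{(n)}\ne0$, the discrete orthogonal convolution (DOC) kernels are $\theta_0^{(n)}:=1/a_0^{(n)}$ and $\theta_{n-k}^{(n)}:=-\frac{1}{a_0^{(k)}}\sum_{j=k+1}^n\theta_{n-j}^{(n)}a_{j-k}^{(j)}$ for $1\le k\le n-1$; the discrete (left-)complementary convolution (DCC) kernels are $p_{n-k}^{(n)}:=\sum_{j=k}^n\theta_{j-k}^{(j)}$ and the right-complementary convolution (RCC) kernels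 are ${}^{r}p_{n-k}^{(n)}:=\sum_{j=k}^n\theta_{n-j}^{(n)}$, for $1\le k\le n$. The kernels $\mathsf p_{n-k}^{(\beta,n)}$ and ${}^{r}\mathsf p_{n-k}^{(\beta,n)}$ are the DCC and RCC kernels of the modified array $\mathsf a_{n-k}^{(\beta,n)}$. Empty sums are zero. *)

theory Defs
  imports "HOL-Analysis.Analysis"
begin

text \<open>
  A triangular array of kernels (\<open>1 \<le> k \<le> n\<close>) is a function \<open>a :: nat \<Rightarrow> nat \<Rightarrow> real\<close>
  indexed by row and column rather than by row and lag: \<open>a n k\<close> is the kernel whose
  superscript is \<open>n\<close> and whose subscript is \<open>n - k\<close>.  In particular \<open>a n n\<close> is the
  kernel with subscript \<open>0\<close>.  Values outside the triangle are irrelevant.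
\<close>

definition step_size :: "(nat \<Rightarrow> real) \<Rightarrow> nat \<Rightarrow> real" where
  "step_size t k = t k - t (k - 1)"

definition step_ratio :: "(nat \<Rightarrow> real) \<Rightarrow> nat \<Rightarrow> real" where
  "step_ratio t k = step_size t k / step_size t (k - 1)"

definition omega :: "real \<Rightarrow> real \<Rightarrow> real" where
  "omega \<beta> x = x powr (\<beta> - 1) / Gamma \<beta>"

definition rho :: "real \<Rightarrow> real \<Rightarrow> real" where
  "rho \<beta> z = (z + 1) powr (1 + \<beta>) - z powr (1 + \<beta>) - 1"

definition r_star :: "real \<Rightarrow> real \<Rightarrow> real" where
  "r_star \<beta> z =
    ((2 powr \<beta> - 1) * rho \<beta> z / (rho \<beta> (2 * z) - rho \<beta> z)) powr (1 / (1 - \<beta>))"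

text \<open>
  For \<open>0 < \<beta> < 1\<close> the inner integrand may be singular at the end point \<open>s = x\<close>, where
  \<open>omega \<beta> 0 = 0\<close> by the convention for \<open>powr\<close>; the value at one point does not
  affect the integral.
\<close>

definition avg_kernel :: "real \<Rightarrow> (nat \<Rightarrow> real) \<Rightarrow> nat \<Rightarrow> nat \<Rightarrow> real" where
  "avg_kernel \<beta> t n k =
    1 / (step_size t n * step_size t k) *
    integral {t (n - 1)..t n}
      (\<lambda>x. integral {t (k - 1)..min x (t k)} (\<lambda>s. omega \<beta> (x - s)))"

definition mod_kernel :: "real \<Rightarrow> (nat \<Rightarrow> real) \<Rightarrow> nat \<Rightarrow> nat \<Rightarrow> real" where
  "mod_kernel \<beta> t n k = (if k = n then 2 * avg_kernel \<beta> t n n else avg_kernel \<beta> t n k)"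

function doc :: "(nat \<Rightarrow> nat \<Rightarrow> real) \<Rightarrow> nat \<Rightarrow> nat \<Rightarrow> real" where
  "doc a n k =
    (if k = n then 1 / a n n
     else if k < n then - (1 / a k k) * (\<Sum>j=k+1..n. doc a n j * a j k)
     else 0)"
  by auto
termination
  by (relation "Wellfounded.measure (\<lambda>(a, n, k). n - k)") auto

text \<open>The defining equation loops as a rewrite rule.\<close>

declare doc.simps [simp del]

definition dcc :: "(nat \<Rightarrow> nat \<Rightarrow> real) \<Rightarrow> nat \<Rightarrow> nat \<Rightarrow> real" where
  "dcc a n k = (\<Sum>j=k..n. doc a j k)"

definition rcc :: "(nat \<Rightarrow> nat \<Rightarrow> real) \<Rightarrow> nat \<Rightarrow> nat \<Rightarrow> real" where
  "rcc a n k = (\<Sum>j=k..n. doc a n j)"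

end

theory Submission
  imports Defs
begin

text \<open>
  Regard the modified kernels as a lower triangular matrix \<open>A\<close>.  The orthogonal kernels are
  its inverse, the left- and right-complementary kernels are the column and row sums of the
  inverse (from \<open>k\<close> to \<open>n\<close>), and \<open>v = A w\<close>.

  The gradient structure is pure algebra.  Halving the diagonal turns the left-hand side into
  \<open>2 * w n * v n - A n n * (w n)\<^sup>2\<close>.  With \<open>R = rcc A n\<close> one has \<open>A n n = 1 / R n\<close>, and \<open>w n\<close> is
  the sum of \<open>R k * (v k - v (k - 1))\<close>; summation by parts does the rest
  (\<open>gradient_identity\<close>, \<open>gradient_structure\<close>) as soon as the \<open>R k\<close> do not vanish.

  The analysis lies in the signs: the off-diagonal entries of the inverse are nonpositive
  and its row and column sums positive.  The quadratic terms are then nonnegative,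
  because \<open>R\<close> is nondecreasing.  The sums are positive because \<open>A\<close> increases along
  rows towards the diagonal and decreases down columns (\<open>dcc_pos\<close>, \<open>rcc_pos\<close>).  The
  off-diagonal entries of the inverse are nonpositive because the ratio
  \<open>A n j / A (n - 1) j\<close> decreases in \<open>j\<close> (\<open>doc_offdiag_nonpos\<close>).

  For this last property there are two cases.  Away from the diagonal, the entries are,
  up to a common factor, averages of \<open>(v - u) powr (\<beta> - 1)\<close> over pairs of disjoint cells, and
  the property is inherited from the kernel, whose logarithm has a negative mixed derivative
  (\<open>block_tp2\<close>).  At the diagonal, three consecutive cells are involved.  After scaling
  the middle cell to length \<open>1\<close>, and with \<open>x\<close>, \<open>y\<close> the lengths of its neighbours, one needs
  \<open>rho \<beta> y * rho \<beta> x \<le> 2 * far_block \<beta> x y\<close>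
  (\<open>rho_product_le\<close>).  For \<open>y \<ge> 1\<close> this follows from concavity, and for \<open>y < 1\<close> from the
  lower bound \<open>r_star\<close> on the step ratio.
\<close>

section \<open>Orthogonal kernels as the inverse of a triangular array\<close>

text \<open>
  The recursion defining \<open>doc\<close> is forward substitution for the left inverse: row \<open>n\<close> of
  \<open>doc a\<close> times column \<open>k\<close> of \<open>a\<close>.
\<close>

lemma doc_left_inverse:
  assumes "k \<le> n" "a k k \<noteq> 0"
  shows "(\<Sum>j=k..n. doc a n j * a j k) = (if k = n then 1 else 0)"
proof (cases "k = n")
  case True
  then show ?thesis using assms by (simp add: doc.simps)
next
  case False
  then have "(\<Sum>j=k..n. doc a n j * a j k) = doc a n k * a k k + (\<Sum>j=k+1..n. doc a n j * a j k)"
    using assms by (simp add: sum.atLeast_Suc_atMost)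
  moreover have "doc a n k * a k k = - (\<Sum>j=k+1..n. doc a n j * a j k)"
    using False assms by (subst doc.simps) auto
  ultimately show ?thesis using False by simp
qed

lemma sum_triangle_swap:
  fixes f :: "nat \<Rightarrow> nat \<Rightarrow> real"
  shows "(\<Sum>j=k..n. \<Sum>i=j..n. f i j) = (\<Sum>i=k..n. \<Sum>j=k..i. f i j)"
  by (subst sum.Sigma, simp, simp, subst sum.Sigma, simp, simp,
      rule sum.reindex_bij_witness[of _ "\<lambda>(i,j). (j,i)" "\<lambda>(i,j). (j,i)"]) auto

text \<open>
  A left inverse of a triangular matrix is also a right inverse.  With \<open>b = a * doc a\<close>,
  associativity gives \<open>b * a = a\<close>; comparing entries of this equation from the diagonal
  outwards forces \<open>b\<close> to be the identity.
\<close>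

lemma doc_right_inverse:
  assumes "k \<le> n" "\<And>i. k \<le> i \<Longrightarrow> i \<le> n \<Longrightarrow> a i i \<noteq> 0"
  shows "(\<Sum>j=k..n. a n j * doc a j k) = (if k = n then 1 else 0)"
  using assms
proof (induction "n - k" arbitrary: k rule: less_induct)
  case less
  define b where "b j = (\<Sum>i=j..n. a n i * doc a i j)" for j
  have "(\<Sum>j=k..n. b j * a j k) = (\<Sum>j=k..n. \<Sum>i=j..n. a n i * doc a i j * a j k)"
    by (simp add: b_def sum_distrib_right)
  also have "\<dots> = (\<Sum>i=k..n. a n i * (\<Sum>j=k..i. doc a i j * a j k))"
    by (subst sum_triangle_swap) (simp add: sum_distrib_left mult.assoc)
  also have "\<dots> = (\<Sum>i=k..n. a n i * (if k = i then 1 else 0))"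
    using less.prems by (intro sum.cong refl) (subst doc_left_inverse, auto)
  also have "\<dots> = a n k" using less.prems by (simp add: sum.delta' if_distrib cong: if_cong)
  finally have eq: "(\<Sum>j=k..n. b j * a j k) = a n k" .
  have "b k = (if k = n then 1 else 0)"
  proof (cases "k = n")
    case True
    then show ?thesis using less.prems by (simp add: b_def doc.simps)
  next
    case False
    have "b j = (if j = n then 1 else 0)" if "j \<in> {k+1..n}" for j
      unfolding b_def using that less.prems by (intro less.hyps) auto
    then have "(\<Sum>j=k+1..n. b j * a j k) = (\<Sum>j=k+1..n. (if j = n then 1 else 0) * a j k)"
      by (intro sum.cong) auto
    also have "\<dots> = a n k"
      using less.prems False by (simp add: if_distrib[of "\<lambda>x. x * _"] sum.delta cong: if_cong)
    finally have "b k * a k k = 0"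
      using eq less.prems False by (simp add: sum.atLeast_Suc_atMost)
    then show ?thesis using False less.prems by simp
  qed
  then show ?case by (simp add: b_def)
qed

lemma doc_solves:
  fixes w v :: "nat \<Rightarrow> real"
  assumes "1 \<le> n" "\<And>i. 1 \<le> i \<Longrightarrow> i \<le> n \<Longrightarrow> a i i \<noteq> 0"
    and v: "\<And>j. 1 \<le> j \<Longrightarrow> j \<le> n \<Longrightarrow> v j = (\<Sum>l=1..j. a j l * w l)"
  shows "(\<Sum>j=1..n. doc a n j * v j) = w n"
proof -
  have "(\<Sum>j=1..n. doc a n j * v j) = (\<Sum>j=1..n. \<Sum>l=1..j. doc a n j * a j l * w l)"
    using v by (simp add: sum_distrib_left mult.assoc)
  also have "\<dots> = (\<Sum>l=1..n. (\<Sum>j=l..n. doc a n j * a j l) * w l)"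
    by (subst sum_triangle_swap[symmetric]) (simp add: sum_distrib_right)
  also have "\<dots> = (\<Sum>l=1..n. (if l = n then 1 else 0) * w l)"
    using assms(2) by (intro sum.cong refl) (subst doc_left_inverse, auto)
  also have "\<dots> = w n"
    using assms(1) by (simp add: if_distrib[of "\<lambda>x. x * _"] sum.delta cong: if_cong)
  finally show ?thesis .
qed

section \<open>Signs of the inverse and of its row and column sums\<close>

text \<open>
  The hypothesis \<open>cross\<close> says that the ratio \<open>a n j / a (n - 1) j\<close> of consecutive rows
  decreases in the column \<open>j\<close>.  If \<open>k < n - 1\<close>, column \<open>k\<close> of the inverse is orthogonal to
  row \<open>n - 1\<close> and has, by induction, its only positive entry in front, where the
  ratio is largest.  Hence its first \<open>n - k\<close> entries have a nonnegative product with row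
  \<open>n\<close>, which the next entry must cancel.
\<close>

lemma doc_offdiag_nonpos:
  assumes pos: "\<And>n k. 1 \<le> k \<Longrightarrow> k \<le> n \<Longrightarrow> n \<le> N \<Longrightarrow> 0 < a n k"
    and cross: "\<And>n k j. 1 \<le> k \<Longrightarrow> k < j \<Longrightarrow> j < n \<Longrightarrow> n \<le> N \<Longrightarrow>
                  a n j * a (n - 1) k \<le> a n k * a (n - 1) j"
    and "1 \<le> k" "k < n" "n \<le> N"
  shows "doc a n k \<le> 0"
  using assms(4,5)
proof (induction n rule: less_induct)
  case (less n)
  have nz: "a i i \<noteq> 0" if "1 \<le> i" "i \<le> n" for i using pos[of i i] that less.prems by simp
  have eq: "(\<Sum>j=k..n. a n j * doc a j k) = 0"
    using doc_right_inverse[of k n a] less.prems nz \<open>1 \<le> k\<close> by simp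
  have "{k..n} = insert n {k..n-1}" using less.prems by auto
  then have an: "a n n * doc a n k = - (\<Sum>j=k..n-1. a n j * doc a j k)"
    using eq less.prems by simp
  have kk: "0 < doc a k k" using pos[of k k] \<open>1 \<le> k\<close> less.prems by (simp add: doc.simps)
  have "0 \<le> a (n - 1) k * (\<Sum>j=k..n-1. a n j * doc a j k)"
  proof -
    have "0 \<le> a n k * (\<Sum>j=k..n-1. a (n - 1) j * doc a j k)"
    proof (cases "k = n - 1")
      case True
      then show ?thesis using pos[of k n] pos[of k k] kk \<open>1 \<le> k\<close> less.prems by simp
    next
      case False
      then show ?thesis
        using doc_right_inverse[of k "n - 1" a] less.prems nz \<open>1 \<le> k\<close> by simp
    qed
    also have "\<dots> = (\<Sum>j=k..n-1. a n k * a (n - 1) j * doc a j k)"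
      by (simp add: sum_distrib_left mult.assoc)
    also have "\<dots> \<le> (\<Sum>j=k..n-1. a n j * a (n - 1) k * doc a j k)"
    proof (intro sum_mono)
      fix j assume j: "j \<in> {k..n-1}"
      show "a n k * a (n - 1) j * doc a j k \<le> a n j * a (n - 1) k * doc a j k"
      proof (cases "j = k")
        case False
        then have "doc a j k \<le> 0" using j less.prems by (intro less.IH) auto
        moreover have "a n j * a (n - 1) k \<le> a n k * a (n - 1) j"
          using False j less.prems \<open>1 \<le> k\<close> by (intro cross) auto
        ultimately show ?thesis by (rule mult_right_mono_neg[rotated])
      qed simp
    qed
    also have "\<dots> = a (n - 1) k * (\<Sum>j=k..n-1. a n j * doc a j k)"
      by (simp add: sum_distrib_left mult_ac)
    finally show ?thesis .
  qed
  moreover have "0 < a (n - 1) k" "0 < a n n"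
    using pos[of k "n - 1"] pos[of n n] less.prems \<open>1 \<le> k\<close> by auto
  ultimately show ?case
    using an by (simp add: zero_le_mult_iff) (metis mult_le_0_iff neg_le_0_iff_le not_le)
qed

text \<open>
  The weights \<open>c\<close> are compared with the single weight \<open>c m\<close>: replacing every weight by
  \<open>c m\<close> increases a sum that vanishes.
\<close>

lemma weighted_sum_pos:
  fixes c x :: "'i \<Rightarrow> real"
  assumes "finite I" "m \<in> I" "0 < c m" "(\<Sum>j\<in>I. c j * x j) = 0"
    and sgn: "\<And>j. j \<in> I \<Longrightarrow> 0 \<le> x j * (c m - c j)"
    and "\<exists>j\<in>I. x j \<noteq> 0 \<and> c j \<noteq> c m"
  shows "0 < (\<Sum>j\<in>I. x j)"
proof -
  obtain i where i: "i \<in> I" "x i \<noteq> 0" "c i \<noteq> c m" using assms by blast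
  have "0 < (\<Sum>j\<in>I. x j * (c m - c j))"
    using i sgn[OF i(1)] sgn \<open>finite I\<close> by (intro sum_pos2[of _ i]) (auto simp: less_le)
  also have "\<dots> = c m * (\<Sum>j\<in>I. x j) - (\<Sum>j\<in>I. c j * x j)"
    by (simp add: algebra_simps sum_subtractf sum_distrib_left)
  finally show ?thesis using assms by (simp add: zero_less_mult_iff)
qed

text \<open>
  Column \<open>k\<close> of the inverse is orthogonal to row \<open>n\<close> of \<open>a\<close>, whose smallest entry, at
  column \<open>k\<close>, meets the only positive entry of the former.  Flattening the row to that
  smallest value therefore makes the product positive.  If all off-diagonal entries vanish,
  the sum is just the positive diagonal entry.
\<close>

lemma dcc_pos:
  assumes pos: "\<And>n k. 1 \<le> k \<Longrightarrow> k \<le> n \<Longrightarrow> n \<le> N \<Longrightarrow> 0 < a n k"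
    and row: "\<And>n k j. 1 \<le> k \<Longrightarrow> k < j \<Longrightarrow> j \<le> n \<Longrightarrow> n \<le> N \<Longrightarrow> a n k < a n j"
    and off: "\<And>n k. 1 \<le> k \<Longrightarrow> k < n \<Longrightarrow> n \<le> N \<Longrightarrow> doc a n k \<le> 0"
    and "1 \<le> k" "k \<le> n" "n \<le> N"
  shows "0 < dcc a n k"
proof (cases "\<exists>j\<in>{k<..n}. doc a j k \<noteq> 0")
  case True
  show ?thesis unfolding dcc_def
  proof (rule weighted_sum_pos[of _ k "a n"])
    show "(\<Sum>j=k..n. a n j * doc a j k) = 0"
    proof -
      have "a i i \<noteq> 0" if "k \<le> i" "i \<le> n" for i using pos[of i i] that assms(4-6) by simp
      then show ?thesis using True assms(4-6) by (subst doc_right_inverse) auto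
    qed
    show "0 \<le> doc a j k * (a n k - a n j)" if "j \<in> {k..n}" for j
      using that row[of k j n] off[of k j] assms(4-6)
      by (cases "j = k") (auto intro!: mult_nonpos_nonpos)
    show "\<exists>j\<in>{k..n}. doc a j k \<noteq> 0 \<and> a n j \<noteq> a n k"
      using True row[of k _ n] assms(4-6) by fastforce
  qed (use pos assms(4-6) in auto)
next
  case False
  have "dcc a n k = doc a k k + (\<Sum>j=k+1..n. doc a j k)"
    using assms(4-6) by (simp add: dcc_def sum.atLeast_Suc_atMost)
  also have "(\<Sum>j=k+1..n. doc a j k) = 0" using False by (intro sum.neutral) auto
  finally show ?thesis using pos[of k k] assms(4-6) by (simp add: doc.simps)
qed

text \<open>
  The transpose of the argument for \<open>dcc_pos\<close>: row \<open>n\<close> of the inverse is orthogonal to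
  column \<open>k\<close> of \<open>a\<close>, whose smallest entry is the last one.
\<close>

lemma rcc_pos:
  assumes pos: "\<And>n k. 1 \<le> k \<Longrightarrow> k \<le> n \<Longrightarrow> n \<le> N \<Longrightarrow> 0 < a n k"
    and col: "\<And>n k j. 1 \<le> k \<Longrightarrow> k \<le> j \<Longrightarrow> j < n \<Longrightarrow> n \<le> N \<Longrightarrow> a n k < a j k"
    and off: "\<And>n k. 1 \<le> k \<Longrightarrow> k < n \<Longrightarrow> n \<le> N \<Longrightarrow> doc a n k \<le> 0"
    and "1 \<le> k" "k \<le> n" "n \<le> N"
  shows "0 < rcc a n k"
proof (cases "\<exists>j\<in>{k..<n}. doc a n j \<noteq> 0")
  case True
  show ?thesis unfolding rcc_def
  proof (rule weighted_sum_pos[of _ n "\<lambda>j. a j k"])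
    show "(\<Sum>j=k..n. a j k * doc a n j) = 0"
      using doc_left_inverse[of k n a] pos[of k k] True assms(4-6)
      by (auto simp: mult.commute)
    show "0 \<le> doc a n j * (a n k - a j k)" if "j \<in> {k..n}" for j
      using that col[of k j n] off[of j n] assms(4-6)
      by (cases "j = n") (auto intro!: mult_nonpos_nonpos)
    show "\<exists>j\<in>{k..n}. doc a n j \<noteq> 0 \<and> a j k \<noteq> a n k"
      using True col[of k _ n] assms(4-6) by fastforce
  qed (use pos assms(4-6) in auto)
next
  case False
  have "{k..n} = insert n {k..<n}" using assms(4-6) by auto
  then have "rcc a n k = doc a n n + (\<Sum>j=k..<n. doc a n j)"
    by (simp add: rcc_def)
  also have "(\<Sum>j=k..<n. doc a n j) = 0" using False by (intro sum.neutral) auto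
  finally show ?thesis using pos[of n n] assms(4-6) by (simp add: doc.simps)
qed

lemma rcc_step: "k < n \<Longrightarrow> rcc a n k = doc a n k + rcc a n (k + 1)"
  by (simp add: rcc_def sum.atLeast_Suc_atMost)

section \<open>The discrete gradient structure of a triangular array\<close>

text \<open>
  Summation by parts.  One step of the induction uses
  \<open>S n = S (n - 1) + R n * (v n - v (n - 1))\<close> to complete a square.
\<close>

lemma gradient_identity:
  fixes R v :: "nat \<Rightarrow> real"
  assumes "1 \<le> n" "\<And>j. 1 \<le> j \<Longrightarrow> j \<le> n \<Longrightarrow> R j \<noteq> 0" "v 0 = 0"
  defines "S \<equiv> \<lambda>j. \<Sum>k=1..j. R k * (v k - v (k - 1))"
  shows "2 * S n * v n - (S n)\<^sup>2 / R n =
    (\<Sum>j=1..n-1. (R j - R (j + 1)) * (v j)\<^sup>2) + R n * (v n)\<^sup>2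
    + (\<Sum>j=1..n-1. (1 / R j - 1 / R (j + 1)) * (S j)\<^sup>2)"
  using assms(1,2)
proof (induction n rule: nat_induct_at_least)
  case base
  then show ?case using \<open>v 0 = 0\<close> by (simp add: S_def field_simps power2_eq_square)
next
  case (Suc n)
  have S: "S (Suc n) = S n + R (Suc n) * (v (Suc n) - v n)" by (simp add: S_def)
  have nz: "R n \<noteq> 0" "R (Suc n) \<noteq> 0" using Suc by auto
  have "{1..Suc n - 1} = insert n {1..n-1}" using Suc by auto
  then have spl: "(\<Sum>j=1..Suc n-1. f j) = f n + (\<Sum>j=1..n-1. f j)" for f :: "nat \<Rightarrow> real"
    using Suc by simp
  have IH: "2 * S n * v n - (S n)\<^sup>2 / R n =
    (\<Sum>j=1..n-1. (R j - R (j + 1)) * (v j)\<^sup>2) + R n * (v n)\<^sup>2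
    + (\<Sum>j=1..n-1. (1 / R j - 1 / R (j + 1)) * (S j)\<^sup>2)"
    using Suc by auto
  have "2 * S (Suc n) * v (Suc n) - (S (Suc n))\<^sup>2 / R (Suc n) =
     2 * S n * v n - (S n)\<^sup>2 / R n - R (Suc n) * (v n)\<^sup>2 + R (Suc n) * (v (Suc n))\<^sup>2
     + (1 / R n - 1 / R (Suc n)) * (S n)\<^sup>2"
    unfolding S using nz by (simp add: field_simps power2_eq_square)
  then show ?case unfolding spl using IH by (simp add: algebra_simps)
qed

lemma sum_by_parts_rcc:
  assumes "v 0 = 0"
  shows "(\<Sum>k=1..n. rcc a n k * (v k - v (k - 1))) = (\<Sum>j=1..n. doc a n j * v j)"
proof -
  have tel: "(\<Sum>k=1..j. v k - v (k - 1)) = v j" for j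
    by (induction j) (auto simp: assms)
  have "(\<Sum>k=1..n. rcc a n k * (v k - v (k - 1)))
      = (\<Sum>k=1..n. \<Sum>j=k..n. doc a n j * (v k - v (k - 1)))"
    by (simp add: rcc_def sum_distrib_right)
  also have "\<dots> = (\<Sum>j=1..n. doc a n j * (\<Sum>k=1..j. v k - v (k - 1)))"
    by (subst sum_triangle_swap) (simp add: sum_distrib_left)
  finally show ?thesis by (simp only: tel)
qed

lemma dcc_energy_diff:
  assumes "1 \<le> n"
  shows "(\<Sum>j=1..n. dcc a n j * x j) - (\<Sum>j=1..n-1. dcc a (n - 1) j * x j)
      = (\<Sum>j=1..n. doc a n j * x j)"
proof -
  have ins: "{1..n} = insert n {1..n-1}" using assms by auto
  have "dcc a n j = dcc a (n - 1) j + doc a n j" if "j \<le> n - 1" for j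
  proof -
    have "{j..n} = insert n {j..n-1}" using that assms by auto
    moreover have "n \<notin> {j..n-1}" using assms by auto
    ultimately show ?thesis by (simp only: dcc_def sum.insert finite_atLeastAtMost) simp
  qed
  then have "(\<Sum>j=1..n-1. dcc a n j * x j)
      = (\<Sum>j=1..n-1. dcc a (n - 1) j * x j) + (\<Sum>j=1..n-1. doc a n j * x j)"
    by (simp add: algebra_simps flip: sum.distrib)
  then show ?thesis unfolding ins using assms by (simp add: dcc_def)
qed

text \<open>
  Only half of the diagonal coefficient occurs on the left, so the left-hand side is
  \<open>2 w v - a n n * w\<^sup>2\<close>, and \<open>a n n = 1 / rcc a n n\<close>.  Since \<open>w n\<close> is the full sum
  \<open>S n\<close> for the weights \<open>R = rcc a n\<close>, this is the left-hand side of
  \<open>gradient_identity\<close>.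
\<close>

lemma gradient_structure:
  fixes w v :: "nat \<Rightarrow> real"
  assumes n: "1 \<le> n" and diag: "\<And>i. 1 \<le> i \<Longrightarrow> i \<le> n \<Longrightarrow> a i i \<noteq> 0"
    and R: "\<And>j. 1 \<le> j \<Longrightarrow> j \<le> n \<Longrightarrow> rcc a n j \<noteq> 0"
    and v0: "v 0 = 0" and v: "\<And>j. 1 \<le> j \<Longrightarrow> j \<le> n \<Longrightarrow> v j = (\<Sum>l=1..j. a j l * w l)"
  shows "2 * w n * (v n - a n n / 2 * w n) =
     (\<Sum>j=1..n. dcc a n j * (v j)\<^sup>2) - (\<Sum>j=1..n-1. dcc a (n - 1) j * (v j)\<^sup>2)
     + (\<Sum>j=1..n-1. (1 / rcc a n j - 1 / rcc a n (j + 1)) *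
          (\<Sum>k=1..j. rcc a n k * (v k - v (k - 1)))\<^sup>2)"
proof -
  have S: "(\<Sum>k=1..n. rcc a n k * (v k - v (k - 1))) = w n"
    using sum_by_parts_rcc[where v=v and a=a and n=n, OF v0]
        doc_solves[where v=v and w=w and a=a, OF n diag v] by simp
  have Rn: "rcc a n n = 1 / a n n" by (simp add: rcc_def doc.simps)
  have ins: "{1..n} = insert n {1..n-1}" using n by auto
  have "(\<Sum>j=1..n. doc a n j * (v j)\<^sup>2) = (\<Sum>j=1..n-1. (rcc a n j - rcc a n (j + 1)) * (v j)\<^sup>2)
      + rcc a n n * (v n)\<^sup>2"
  proof -
    have "doc a n j = rcc a n j - rcc a n (j + 1)" if "j \<in> {1..n-1}" for j
      using rcc_step[of j n a] that n by auto
    then show ?thesis unfolding ins using n by (simp add: rcc_def)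
  qed
  then show ?thesis
    using gradient_identity[where v=v and R="rcc a n", OF n R v0] n
    unfolding dcc_energy_diff[OF n] S
    by (simp add: Rn power2_eq_square algebra_simps)
qed

section \<open>Increments of concave powers\<close>

text \<open>
  Split \<open>z powr \<beta> = z * z powr (\<beta> - 1)\<close>; the second factor decreases in \<open>z\<close>.
\<close>

lemma powr_subadditive:
  fixes \<beta> x y :: real
  assumes "0 < \<beta>" "\<beta> < 1" "0 \<le> x" "0 \<le> y"
  shows "(x + y) powr \<beta> \<le> x powr \<beta> + y powr \<beta>"
proof (cases "x = 0 \<or> y = 0")
  case True
  then show ?thesis by auto
next
  case False
  with assms have xy: "0 < x" "0 < y" by auto
  have split: "z powr \<beta> = z * z powr (\<beta> - 1)" if "0 < z" for z :: real
    using that by (simp add: powr_diff)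
  have "(x + y) powr \<beta> = x * (x + y) powr (\<beta> - 1) + y * (x + y) powr (\<beta> - 1)"
    using xy by (subst split) (auto simp: algebra_simps)
  also have "\<dots> \<le> x * x powr (\<beta> - 1) + y * y powr (\<beta> - 1)"
    using xy assms by (intro add_mono mult_left_mono powr_mono2') auto
  finally show ?thesis using xy by (simp add: split)
qed

lemma powr_increment_antimono:
  fixes \<beta> a b d :: real
  assumes "0 < \<beta>" "\<beta> < 1" "0 \<le> a" "a \<le> b" "0 \<le> d"
  shows "(b + d) powr \<beta> - b powr \<beta> \<le> (a + d) powr \<beta> - a powr \<beta>"
proof -
  let ?f = "\<lambda>s. s powr \<beta> - (s + d) powr \<beta>"
  have "?f a \<le> ?f b"
  proof (rule DERIV_nonneg_imp_increasing_open[where f="?f" and a="a" and b="b"])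
    fix s assume "a < s" "s < b"
    then have s: "0 < s" using assms by simp
    have "(s + d) powr (\<beta> - 1) \<le> s powr (\<beta> - 1)"
      using s assms by (intro powr_mono2') auto
    then have "0 \<le> \<beta> * s powr (\<beta> - 1) - \<beta> * (s + d) powr (\<beta> - 1)"
      using assms by (simp add: mult_left_mono)
    moreover have "(?f has_real_derivative \<beta> * s powr (\<beta> - 1) - \<beta> * (s + d) powr (\<beta> - 1)) (at s)"
      using s assms by (auto intro!: derivative_eq_intros)
    ultimately show "\<exists>y. (?f has_real_derivative y) (at s) \<and> 0 \<le> y" by blast
  qed (use assms in \<open>auto intro!: continuous_intros continuous_on_powr'\<close>)
  then show ?thesis by simp
qed

lemma powr_increment_strict_antimono:
  fixes \<beta> a b d :: real
  assumes "0 < \<beta>" "\<beta> < 1" "0 \<le> a" "a < b" "0 < d"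
  shows "(b + d) powr \<beta> - b powr \<beta> < (a + d) powr \<beta> - a powr \<beta>"
proof -
  let ?f = "\<lambda>s. s powr \<beta> - (s + d) powr \<beta>"
  have "?f a < ?f b"
  proof (rule DERIV_pos_imp_increasing_open[where f="?f" and a="a" and b="b"])
    fix s assume "a < s" "s < b"
    then have s: "0 < s" using assms by simp
    have "(s + d) powr (\<beta> - 1) < s powr (\<beta> - 1)"
      using s assms by (intro powr_less_mono2_neg) auto
    then have "0 < \<beta> * s powr (\<beta> - 1) - \<beta> * (s + d) powr (\<beta> - 1)"
      using assms by simp
    moreover have "(?f has_real_derivative \<beta> * s powr (\<beta> - 1) - \<beta> * (s + d) powr (\<beta> - 1)) (at s)"
      using s assms by (auto intro!: derivative_eq_intros)
    ultimately show "\<exists>y. (?f has_real_derivative y) (at s) \<and> 0 < y" by blast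
  qed (use assms in \<open>auto intro!: continuous_intros continuous_on_powr'\<close>)
  then show ?thesis by simp
qed

text \<open>
  Concavity of \<open>x powr \<beta>\<close>, for intervals that need not be adjacent.
\<close>

lemma powr_slope_strict_antimono:
  fixes \<beta> a b c d :: real
  assumes "0 < \<beta>" "\<beta> < 1" "0 \<le> a" "a < b" "b \<le> c" "c < d"
  shows "(d powr \<beta> - c powr \<beta>) / (d - c) < (b powr \<beta> - a powr \<beta>) / (b - a)"
proof -
  have mvt: "\<exists>z. u < z \<and> z < v \<and> (v powr \<beta> - u powr \<beta>) / (v - u) = \<beta> * z powr (\<beta> - 1)"
    if "0 \<le> u" "u < v" for u v :: real
  proof -
    have der: "((\<lambda>x. x powr \<beta>) has_real_derivative \<beta> * s powr (\<beta> - 1)) (at s)" if "u < s" for s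
      using that \<open>0 \<le> u\<close> by (auto intro!: derivative_eq_intros)
    have "\<exists>l z. u < z \<and> z < v \<and> ((\<lambda>x. x powr \<beta>) has_real_derivative l) (at z)
        \<and> v powr \<beta> - u powr \<beta> = (v - u) * l"
      using that assms der
      by (intro MVT) (auto simp: real_differentiable_def
          intro!: continuous_intros continuous_on_powr')
    then obtain l z where z: "u < z" "z < v" "((\<lambda>x. x powr \<beta>) has_real_derivative l) (at z)"
      "v powr \<beta> - u powr \<beta> = (v - u) * l" by blast
    have "l = \<beta> * z powr (\<beta> - 1)" using DERIV_unique[OF z(3) der[OF z(1)]] .
    then show ?thesis using z that by (intro exI[of _ z]) simp
  qed
  obtain z1 where z1: "a < z1" "z1 < b" "(b powr \<beta> - a powr \<beta>) / (b - a) = \<beta> * z1 powr (\<beta> - 1)"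
    using mvt[of a b] assms by auto
  obtain z2 where z2: "c < z2" "z2 < d" "(d powr \<beta> - c powr \<beta>) / (d - c) = \<beta> * z2 powr (\<beta> - 1)"
    using mvt[of c d] assms by auto
  have "z2 powr (\<beta> - 1) < z1 powr (\<beta> - 1)"
    using z1 z2 assms by (intro powr_less_mono2_neg) auto
  then show ?thesis using z1(3) z2(3) assms by simp
qed

text \<open>
  The left-hand side is \<open>(1 + \<beta>) * \<beta>\<close> times the integral of \<open>(x - s) powr (\<beta> - 1)\<close> over a
  pair of adjacent cells of lengths \<open>\<sigma>\<close> and \<open>\<tau>\<close>.  Its derivative in \<open>\<sigma>\<close> is at most
  \<open>(1 + \<beta>) * \<tau> powr \<beta>\<close> by subadditivity, and \<open>1 + \<beta> < 2\<close>.
\<close>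

lemma adjacent_block_bound:
  fixes \<beta> \<sigma> \<tau> :: real
  assumes "0 < \<beta>" "\<beta> < 1" "0 < \<sigma>" "0 < \<tau>"
  shows "(\<tau> + \<sigma>) powr (1 + \<beta>) - \<tau> powr (1 + \<beta>) - \<sigma> powr (1 + \<beta>) < 2 * \<sigma> * \<tau> powr \<beta>"
proof -
  let ?f = "\<lambda>s. (1 + \<beta>) * s * \<tau> powr \<beta> - ((\<tau> + s) powr (1 + \<beta>) - \<tau> powr (1 + \<beta>) - s powr (1 + \<beta>))"
  have "?f 0 \<le> ?f \<sigma>"
  proof (rule DERIV_nonneg_imp_increasing_open[where f="?f" and a="0" and b="\<sigma>"])
    fix s assume "0 < s" "s < \<sigma>"
    have "0 \<le> (1 + \<beta>) * (\<tau> powr \<beta> - ((\<tau> + s) powr \<beta> - s powr \<beta>))"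
      using powr_subadditive[of \<beta> \<tau> s] assms \<open>0 < s\<close> by simp
    moreover have "(?f has_real_derivative
        (1 + \<beta>) * (\<tau> powr \<beta> - ((\<tau> + s) powr \<beta> - s powr \<beta>))) (at s)"
      using \<open>0 < s\<close> assms by (auto intro!: derivative_eq_intros simp: algebra_simps)
    ultimately show "\<exists>y. (?f has_real_derivative y) (at s) \<and> 0 \<le> y" by blast
  qed (use assms in \<open>auto intro!: continuous_intros continuous_on_powr'\<close>)
  then have "(\<tau> + \<sigma>) powr (1 + \<beta>) - \<tau> powr (1 + \<beta>) - \<sigma> powr (1 + \<beta>) \<le> (1 + \<beta>) * (\<sigma> * \<tau> powr \<beta>)"
    using assms by (simp add: mult.assoc)
  also have "\<dots> < 2 * (\<sigma> * \<tau> powr \<beta>)"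
    using assms by (intro mult_strict_right_mono) auto
  finally show ?thesis by simp
qed

section \<open>Three consecutive cells and the lower bound on the step ratio\<close>

text \<open>
  Up to the factor \<open>\<beta> * (1 + \<beta>)\<close> this is the double integral of
  \<open>(1 + u + v) powr (\<beta> - 1)\<close> over \<open>0 < u < x\<close>, \<open>0 < v < y\<close>: the interaction of two cells of
  lengths \<open>x\<close> and \<open>y\<close> that are separated by a cell of length \<open>1\<close>.  In the same way
  \<open>rho \<beta> z\<close> is the interaction of adjacent cells of lengths \<open>1\<close> and \<open>z\<close>.
\<close>

definition far_block :: "real \<Rightarrow> real \<Rightarrow> real \<Rightarrow> real" where
  "far_block \<beta> x y =
    (1 + x + y) powr (1 + \<beta>) - (1 + y) powr (1 + \<beta>) - (1 + x) powr (1 + \<beta>) + 1"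

text \<open>
  Both sides vanish at \<open>y = 0\<close>, so it is enough to compare derivatives in \<open>y\<close>.  There
  \<open>(1 + x) powr \<beta> - x powr \<beta> \<le> (1 + x) powr (\<beta> - 1)\<close> reduces the claim to
  \<open>(1 + v) * (1 + x) \<ge> 1 + x + v\<close>.
\<close>

lemma powr_increment_product_le:
  fixes \<beta> x y :: real
  assumes "0 < \<beta>" "\<beta> < 1" "0 < x" "0 \<le> y"
  shows "((1 + y) powr \<beta> - 1) * ((1 + x) powr \<beta> - x powr \<beta>) \<le> (1 + x + y) powr \<beta> - (1 + x) powr \<beta>"
proof -
  define d where "d = (1 + x) powr \<beta> - x powr \<beta>"
  have "x * (1 + x) powr (\<beta> - 1) \<le> x * x powr (\<beta> - 1)"
    using assms by (intro mult_left_mono powr_mono2') auto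
  then have "d \<le> (1 + x) powr \<beta> - x * (1 + x) powr (\<beta> - 1)"
    unfolding d_def using assms by (simp add: powr_diff)
  also have "\<dots> = (1 + x) powr (\<beta> - 1)"
    using assms by (simp add: powr_diff field_simps)
  finally have d: "d \<le> (1 + x) powr (\<beta> - 1)" .
  let ?f = "\<lambda>v. (1 + x + v) powr \<beta> - (1 + v) powr \<beta> * d"
  have "?f 0 \<le> ?f y"
  proof (rule DERIV_nonneg_imp_increasing_open[where f="?f" and a="0" and b="y"])
    fix v assume v: "0 < v" "v < y"
    have "(1 + v) powr (\<beta> - 1) * d \<le> (1 + v) powr (\<beta> - 1) * (1 + x) powr (\<beta> - 1)"
      using d by (intro mult_left_mono) auto
    also have "\<dots> = ((1 + v) * (1 + x)) powr (\<beta> - 1)"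
      using v assms by (simp add: powr_mult)
    also have "\<dots> \<le> (1 + x + v) powr (\<beta> - 1)"
      using v assms by (intro powr_mono2') (auto simp: algebra_simps)
    finally have "0 \<le> \<beta> * ((1 + x + v) powr (\<beta> - 1) - (1 + v) powr (\<beta> - 1) * d)"
      using assms by simp
    moreover have "(?f has_real_derivative
        \<beta> * ((1 + x + v) powr (\<beta> - 1) - (1 + v) powr (\<beta> - 1) * d)) (at v)"
      using v assms by (auto intro!: derivative_eq_intros simp: algebra_simps)
    ultimately show "\<exists>y. (?f has_real_derivative y) (at v) \<and> 0 \<le> y" by blast
  qed (use assms in \<open>auto intro!: continuous_intros continuous_on_powr'\<close>)
  then show ?thesis unfolding d_def by (simp add: algebra_simps)
qed

text \<open>
  The factor \<open>(1 + y) powr \<beta> - 1\<close> is the limit of \<open>far_block \<beta> x y / rho \<beta> x\<close> as \<open>x\<close> tends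
  to \<open>0\<close>.  The inequality is obtained by integrating \<open>powr_increment_product_le\<close> in \<open>x\<close>.
\<close>

lemma far_block_ge:
  fixes \<beta> x y :: real
  assumes "0 < \<beta>" "\<beta> < 1" "0 < x" "0 < y"
  shows "((1 + y) powr \<beta> - 1) * rho \<beta> x \<le> far_block \<beta> x y"
proof -
  define c where "c = (1 + y) powr \<beta> - 1"
  let ?f = "\<lambda>s. far_block \<beta> s y - c * rho \<beta> s"
  have "?f 0 \<le> ?f x"
  proof (rule DERIV_nonneg_imp_increasing_open[where f="?f" and a="0" and b="x"])
    fix s assume s: "0 < s" "s < x"
    have "0 \<le> (1 + \<beta>) * ((1 + s + y) powr \<beta> - (1 + s) powr \<beta> - c * ((1 + s) powr \<beta> - s powr \<beta>))"
      using powr_increment_product_le[of \<beta> s y] s assms by (simp add: c_def)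
    moreover have "(?f has_real_derivative
        (1 + \<beta>) * ((1 + s + y) powr \<beta> - (1 + s) powr \<beta> - c * ((1 + s) powr \<beta> - s powr \<beta>))) (at s)"
      unfolding far_block_def rho_def
      using s assms by (auto intro!: derivative_eq_intros simp: algebra_simps)
    ultimately show "\<exists>y. (?f has_real_derivative y) (at s) \<and> 0 \<le> y" by blast
  qed (use assms in \<open>auto simp: far_block_def rho_def
      intro!: continuous_intros continuous_on_powr'\<close>)
  then show ?thesis using assms by (simp add: c_def far_block_def rho_def)
qed

lemma powr_le_affine:
  fixes \<beta> z :: real
  assumes "0 < \<beta>" "\<beta> < 1" "0 < z"
  shows "z powr \<beta> \<le> 1 - \<beta> + \<beta> * z"
  using Youngs_inequality_0[of "1 - \<beta>" \<beta> 1 z] assms by simp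

text \<open>
  After division by \<open>y powr \<beta>\<close> the claim reads
  \<open>y powr - \<beta> + (y - 1) * (1 + 1 / y) powr \<beta> \<le> y\<close>.  The left-hand side is convex in \<open>\<beta>\<close> and
  equals \<open>y\<close> at \<open>\<beta> = 0\<close> and \<open>\<beta> = 1\<close>; \<open>powr_le_affine\<close> bounds each power by its chord.
\<close>

lemma rho_le_of_ge_1:
  fixes \<beta> y :: real
  assumes "0 < \<beta>" "\<beta> < 1" "1 \<le> y"
  shows "rho \<beta> y \<le> 2 * ((1 + y) powr \<beta> - 1)"
proof -
  have "(1 / y) powr \<beta> \<le> 1 - \<beta> + \<beta> * (1 / y)"
    using assms by (intro powr_le_affine) auto
  moreover have "(y - 1) * (1 + 1 / y) powr \<beta> \<le> (y - 1) * (1 - \<beta> + \<beta> * (1 + 1 / y))"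
    using assms by (intro mult_left_mono powr_le_affine) (auto intro: add_pos_pos)
  ultimately have "(1 / y) powr \<beta> + (y - 1) * (1 + 1 / y) powr \<beta>
      \<le> 1 - \<beta> + \<beta> * (1 / y) + (y - 1) * (1 - \<beta> + \<beta> * (1 + 1 / y))" by linarith
  also have "\<dots> = y" using assms by (simp add: field_simps)
  finally have "y powr \<beta> * ((1 / y) powr \<beta> + (y - 1) * (1 + 1 / y) powr \<beta>) \<le> y powr \<beta> * y"
    by (intro mult_left_mono) auto
  moreover have "y powr \<beta> * (1 / y) powr \<beta> = 1"
    using assms by (simp flip: powr_mult)
  moreover have "y powr \<beta> * (1 + 1 / y) powr \<beta> = (1 + y) powr \<beta>"
    using assms by (simp add: algebra_simps flip: powr_mult)
  ultimately have "1 + (y - 1) * (1 + y) powr \<beta> \<le> y powr \<beta> * y"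
    by (simp add: algebra_simps)
  moreover have "(y + 1) powr (1 + \<beta>) = (1 + y) * (1 + y) powr \<beta>"
    using assms by (simp add: powr_add add.commute)
  moreover have "y powr (1 + \<beta>) = y * y powr \<beta>"
    using assms by (simp add: powr_add)
  ultimately show ?thesis by (simp add: rho_def algebra_simps)
qed

lemma rho_1: "rho \<beta> 1 = 2 * (2 powr \<beta> - 1)"
  by (simp add: rho_def powr_add)

text \<open>
  Interchange of the two adjacent cells, followed by rescaling.
\<close>

lemma rho_reciprocal:
  fixes \<beta> r :: real
  assumes "0 < r"
  shows "rho \<beta> r = r powr (1 + \<beta>) * rho \<beta> (1 / r)"
proof -
  have "r powr (1 + \<beta>) * (1 / r + 1) powr (1 + \<beta>) = (r * (1 / r + 1)) powr (1 + \<beta>)"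
    using assms by (simp add: powr_mult)
  moreover have "r * (1 / r + 1) = r + 1"
    using assms by (simp add: field_simps)
  moreover have "r powr (1 + \<beta>) * (1 / r) powr (1 + \<beta>) = 1"
    using assms by (simp flip: powr_mult)
  ultimately show ?thesis by (simp add: rho_def algebra_simps)
qed

text \<open>
  By \<open>rho_reciprocal\<close> this says that \<open>rho \<beta> z \<le> z * rho \<beta> 1\<close> for \<open>z = 1 / y \<ge> 1\<close>.  That holds
  because the slope of \<open>rho \<beta>\<close> decreases and its value at \<open>1\<close>, which is
  \<open>(1 + \<beta>) * (2 powr \<beta> - 1)\<close>, is at most \<open>rho \<beta> 1\<close>.
\<close>

lemma rho_le_of_le_1:
  fixes \<beta> y :: real
  assumes "0 < \<beta>" "\<beta> < 1" "0 < y" "y \<le> 1"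
  shows "rho \<beta> y \<le> rho \<beta> 1 * y powr \<beta>"
proof -
  have ge: "0 \<le> 2 powr \<beta> - (1::real)" using assms ge_one_powr_ge_zero[of 2 \<beta>] by simp
  let ?f = "\<lambda>z. rho \<beta> 1 * z - rho \<beta> z"
  have "?f 1 \<le> ?f (1 / y)"
  proof (rule DERIV_nonneg_imp_increasing_open[where f="?f" and a="1" and b="(1 / y)"])
    fix z assume z: "1 < z" "z < 1 / y"
    have "(1 + \<beta>) * ((z + 1) powr \<beta> - z powr \<beta>) \<le> (1 + \<beta>) * (2 powr \<beta> - 1)"
      using powr_increment_antimono[of \<beta> 1 z 1] z assms by simp
    also have "\<dots> \<le> 2 * (2 powr \<beta> - 1)"
      using assms ge by (intro mult_right_mono) auto
    finally have "0 \<le> rho \<beta> 1 - (1 + \<beta>) * ((z + 1) powr \<beta> - z powr \<beta>)"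
      by (simp add: rho_1)
    moreover have "(?f has_real_derivative
        rho \<beta> 1 - (1 + \<beta>) * ((z + 1) powr \<beta> - z powr \<beta>)) (at z)"
      unfolding rho_def using z assms
      by (auto intro!: derivative_eq_intros simp: algebra_simps)
    ultimately show "\<exists>y. (?f has_real_derivative y) (at z) \<and> 0 \<le> y" by blast
  qed (use assms in \<open>auto simp: rho_def intro!: continuous_intros continuous_on_powr'\<close>)
  then have "rho \<beta> (1 / y) \<le> rho \<beta> 1 / y" by simp
  then have "y powr (1 + \<beta>) * rho \<beta> (1 / y) \<le> y powr (1 + \<beta>) * (rho \<beta> 1 / y)"
    by (intro mult_left_mono) auto
  moreover have "y powr (1 + \<beta>) * rho \<beta> (1 / y) = rho \<beta> y"
    using rho_reciprocal[of y \<beta>] assms by simp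
  moreover have "y powr (1 + \<beta>) * (rho \<beta> 1 / y) = rho \<beta> 1 * y powr \<beta>"
    using assms by (simp add: powr_add)
  ultimately show ?thesis by simp
qed

text \<open>
  A chord of the function \<open>far_block \<beta> x\<close>, which is concave and vanishes at \<open>0\<close>.
\<close>

lemma far_block_ge_linear:
  fixes \<beta> x y :: real
  assumes "0 < \<beta>" "\<beta> < 1" "0 < x" "0 < y" "y \<le> 1"
  shows "y * far_block \<beta> x 1 \<le> far_block \<beta> x y"
proof -
  let ?f = "\<lambda>v. far_block \<beta> x (v * y) - y * far_block \<beta> x v"
  have "?f 0 \<le> ?f 1"
  proof (rule DERIV_nonneg_imp_increasing_open[where f="?f" and a="0" and b="1"])
    fix v :: real assume v: "0 < v" "v < 1"
    let ?D = "y * (1 + \<beta>) * (((1 + v * y + x) powr \<beta> - (1 + v * y) powr \<beta>)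
        - ((1 + v + x) powr \<beta> - (1 + v) powr \<beta>))"
    have "v * y \<le> v" using v assms by (simp add: mult_left_le)
    then have "(1 + v + x) powr \<beta> - (1 + v) powr \<beta> \<le> (1 + v * y + x) powr \<beta> - (1 + v * y) powr \<beta>"
      using v assms by (intro powr_increment_antimono) auto
    then have "0 \<le> ?D" using assms by simp
    moreover have "(?f has_real_derivative ?D) (at v)"
      unfolding far_block_def using v assms
      by (auto intro!: derivative_eq_intros simp: algebra_simps add_pos_pos)
    ultimately show "\<exists>y. (?f has_real_derivative y) (at v) \<and> 0 \<le> y" by blast
  qed (use assms in \<open>auto simp: far_block_def intro!: continuous_intros continuous_on_powr'\<close>)
  then show ?thesis by (simp add: far_block_def)
qed

lemma rho_pos:
  fixes \<beta> z :: real
  assumes "0 < \<beta>" "\<beta> < 1" "0 < z"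
  shows "0 < rho \<beta> z"
proof -
  have "1 < (z + 1) powr \<beta>" using assms by (intro gr_one_powr) auto
  moreover have "z * z powr \<beta> \<le> z * (z + 1) powr \<beta>"
    using assms by (intro mult_left_mono powr_mono2) auto
  ultimately have "1 + z * z powr \<beta> < (z + 1) powr \<beta> + z * (z + 1) powr \<beta>" by linarith
  then show ?thesis using assms by (simp add: rho_def powr_add algebra_simps)
qed

text \<open>
  This is what the lower bound on the step ratios is for.  For \<open>y \<ge> 1\<close> the claim combines
  \<open>rho_le_of_ge_1\<close> and \<open>far_block_ge\<close>.  If \<open>y \<le> 1\<close>, the bound says, with \<open>x = 1 / r\<close>, that
  \<open>(2 powr \<beta> - 1) * rho \<beta> x \<le> y powr (1 - \<beta>) * far_block \<beta> x 1\<close>.  This is the claim up to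
  the two estimates \<open>rho \<beta> y \<le> rho \<beta> 1 * y powr \<beta>\<close> and
  \<open>y * far_block \<beta> x 1 \<le> far_block \<beta> x y\<close>, which transfer the case \<open>y = 1\<close> to smaller \<open>y\<close>.
\<close>

lemma rho_product_le:
  fixes \<beta> r y :: real
  assumes b: "0 < \<beta>" "\<beta> < 1" and r: "0 < r" and y: "0 < y" and ge: "r_star \<beta> r \<le> y"
  shows "rho \<beta> y * rho \<beta> (1 / r) \<le> 2 * far_block \<beta> (1 / r) y"
proof (cases "1 \<le> y")
  case True
  have "rho \<beta> y * rho \<beta> (1 / r) \<le> 2 * ((1 + y) powr \<beta> - 1) * rho \<beta> (1 / r)"
    using rho_le_of_ge_1[OF b True] rho_pos[OF b, of "1 / r"] r
    by (intro mult_right_mono) auto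
  also have "\<dots> \<le> 2 * far_block \<beta> (1 / r) y"
    using far_block_ge[OF b, of "1 / r" y] r y by (simp only: mult.assoc) simp
  finally show ?thesis .
next
  case False
  have c: "0 < 2 powr \<beta> - (1::real)" using gr_one_powr[of 2 \<beta>] b by simp
  have p: "0 < r powr (1 + \<beta>)" using r by simp
  note rx = rho_reciprocal[OF r, of \<beta>]
  have rd: "rho \<beta> (2 * r) - rho \<beta> r = r powr (1 + \<beta>) * far_block \<beta> (1 / r) 1"
  proof -
    have args: "2 * r + 1 = r * (2 + 1 / r)" "r + 1 = r * (1 + 1 / r)"
      using r by (simp_all add: field_simps)
    have "(2 * r + 1) powr (1 + \<beta>) = r powr (1 + \<beta>) * (2 + 1 / r) powr (1 + \<beta>)"
      "(r + 1) powr (1 + \<beta>) = r powr (1 + \<beta>) * (1 + 1 / r) powr (1 + \<beta>)"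
      "(2 * r) powr (1 + \<beta>) = r powr (1 + \<beta>) * 2 powr (1 + \<beta>)"
      unfolding args using r by (simp_all add: powr_mult)
    then show ?thesis by (simp add: rho_def far_block_def algebra_simps)
  qed
  have Apos: "0 < far_block \<beta> (1 / r) 1"
    using far_block_ge[OF b, of "1 / r" 1] rho_pos[OF b, of "1 / r"] r c
    by (smt (verit) mult_pos_pos divide_pos_pos)
  define q where "q = (2 powr \<beta> - 1) * rho \<beta> (1 / r) / far_block \<beta> (1 / r) 1"
  have q: "0 < q" unfolding q_def using c Apos rho_pos[OF b, of "1 / r"] r by simp
  have "(2 powr \<beta> - 1) * rho \<beta> r / (rho \<beta> (2 * r) - rho \<beta> r) = q"
    unfolding q_def by (subst rd, subst rx) (use p in simp)
  then have "q powr (1 / (1 - \<beta>)) \<le> y"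
    using ge by (simp add: r_star_def)
  then have "(q powr (1 / (1 - \<beta>))) powr (1 - \<beta>) \<le> y powr (1 - \<beta>)"
    using b by (intro powr_mono2) auto
  then have "q \<le> y powr (1 - \<beta>)" using q b by (simp add: powr_powr)
  then have 1: "(2 powr \<beta> - 1) * rho \<beta> (1 / r) \<le> y powr (1 - \<beta>) * far_block \<beta> (1 / r) 1"
    using Apos by (simp add: q_def field_simps)
  have "(2 powr \<beta> - 1) * (rho \<beta> y * rho \<beta> (1 / r)) = rho \<beta> y * ((2 powr \<beta> - 1) * rho \<beta> (1 / r))"
    by simp
  also have "\<dots> \<le> rho \<beta> y * (y powr (1 - \<beta>) * far_block \<beta> (1 / r) 1)"
    using 1 rho_pos[OF b y] by (intro mult_left_mono) auto
  also have "\<dots> \<le> rho \<beta> 1 * y powr \<beta> * (y powr (1 - \<beta>) * far_block \<beta> (1 / r) 1)"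
    using rho_le_of_le_1[OF b y] False Apos by (intro mult_right_mono) auto
  also have "\<dots> = rho \<beta> 1 * (y * far_block \<beta> (1 / r) 1)"
  proof -
    have "y powr \<beta> * y powr (1 - \<beta>) = y" using y by (simp flip: powr_add)
    then show ?thesis by (metis mult.assoc)
  qed
  also have "\<dots> \<le> rho \<beta> 1 * far_block \<beta> (1 / r) y"
    using far_block_ge_linear[OF b, of "1 / r" y] False r y c
    by (intro mult_left_mono) (auto simp: rho_1)
  also have "\<dots> = (2 powr \<beta> - 1) * (2 * far_block \<beta> (1 / r) y)" by (simp add: rho_1)
  finally show ?thesis using c by simp
qed

section \<open>Interaction of two separated cells\<close>

text \<open>
  Up to the factor \<open>\<beta> * (1 + \<beta>)\<close> this is the integral of \<open>(v - u) powr (\<beta> - 1)\<close> over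
  \<open>a < u < b\<close>, \<open>x < v < y\<close>, provided that \<open>b \<le> x\<close>.  The grouping exhibits it as an increment
  in the second variable.
\<close>

definition block :: "real \<Rightarrow> real \<Rightarrow> real \<Rightarrow> real \<Rightarrow> real \<Rightarrow> real" where
  "block \<beta> a b x y = ((y - a) powr (1 + \<beta>) - (y - b) powr (1 + \<beta>))
     - ((x - a) powr (1 + \<beta>) - (x - b) powr (1 + \<beta>))"

lemma DERIV_block:
  assumes "0 < \<beta>" "a < b" "b < s"
  shows "((\<lambda>s. (s - a) powr (1 + \<beta>) - (s - b) powr (1 + \<beta>)) has_real_derivative
           (1 + \<beta>) * ((s - a) powr \<beta> - (s - b) powr \<beta>)) (at s)"
  using assms by (auto intro!: derivative_eq_intros simp: algebra_simps)

lemma continuous_on_block: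
  assumes "0 < \<beta>" "a \<le> x" "b \<le> x"
  shows "continuous_on {x..y} (\<lambda>s. (s - a) powr (1 + \<beta>) - (s - b) powr (1 + \<beta>) :: real)"
  using assms by (auto intro!: continuous_intros continuous_on_powr')

lemma block_mvt:
  assumes "0 < \<beta>" "a < b" "b \<le> x" "x < y"
  obtains s where "x < s" "s < y"
    "block \<beta> a b x y / (y - x) = (1 + \<beta>) * ((s - a) powr \<beta> - (s - b) powr \<beta>)"
proof -
  let ?H = "\<lambda>s. (s - a) powr (1 + \<beta>) - (s - b) powr (1 + \<beta>)"
  have "\<exists>l z. x < z \<and> z < y \<and> (?H has_real_derivative l) (at z) \<and> ?H y - ?H x = (y - x) * l"
    using assms DERIV_block[of \<beta> a b]
    by (intro MVT continuous_on_block) (force simp: real_differentiable_def)+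
  then obtain l z where z: "x < z" "z < y" "(?H has_real_derivative l) (at z)"
      "?H y - ?H x = (y - x) * l" by blast
  have "l = (1 + \<beta>) * ((z - a) powr \<beta> - (z - b) powr \<beta>)"
    using DERIV_unique[OF z(3) DERIV_block] assms z by simp
  then show thesis using z assms that[of z] by (simp add: block_def)
qed

lemma block_pos:
  assumes "0 < \<beta>" "a < b" "b \<le> x" "x < y"
  shows "0 < block \<beta> a b x y"
proof -
  obtain s where s: "x < s" "s < y"
    "block \<beta> a b x y / (y - x) = (1 + \<beta>) * ((s - a) powr \<beta> - (s - b) powr \<beta>)"
    using block_mvt[OF assms] .
  have "(s - b) powr \<beta> < (s - a) powr \<beta>" using s assms by (intro powr_less_mono2) auto
  then have "0 < block \<beta> a b x y / (y - x)" using s assms by simp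
  then show ?thesis using assms by (simp add: zero_less_divide_iff)
qed

text \<open>
  The averages over \<open>v\<close> are values at intermediate points, and the integral of
  \<open>(v - u) powr (\<beta> - 1)\<close> over \<open>a < u < b\<close> decreases in \<open>v\<close>.
\<close>

lemma block_column_antimono:
  assumes "0 < \<beta>" "\<beta> < 1" "a < b" "b \<le> x" "x < y" "y \<le> z" "z < u"
  shows "block \<beta> a b z u / (u - z) < block \<beta> a b x y / (y - x)"
proof -
  obtain s where s: "x < s" "s < y"
    "block \<beta> a b x y / (y - x) = (1 + \<beta>) * ((s - a) powr \<beta> - (s - b) powr \<beta>)"
    using block_mvt[of \<beta> a b x y] assms by auto
  obtain s' where s': "z < s'" "s' < u"
    "block \<beta> a b z u / (u - z) = (1 + \<beta>) * ((s' - a) powr \<beta> - (s' - b) powr \<beta>)"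
    using block_mvt[of \<beta> a b z u] assms by auto
  have "(s' - b + (b - a)) powr \<beta> - (s' - b) powr \<beta> < (s - b + (b - a)) powr \<beta> - (s - b) powr \<beta>"
    using s s' assms by (intro powr_increment_strict_antimono) auto
  then show ?thesis using s(3) s'(3) assms by simp
qed

lemma block_row_mono:
  assumes "0 < \<beta>" "\<beta> < 1" "a < b" "b \<le> c" "c < d" "d \<le> x" "x < y"
  shows "block \<beta> a b x y / (b - a) < block \<beta> c d x y / (d - c)"
proof -
  let ?H = "\<lambda>a b s. (s - a) powr (1 + \<beta>) - (s - b) powr (1 + \<beta>)"
  let ?f = "\<lambda>s. ?H c d s / (d - c) - ?H a b s / (b - a)"
  have "?f x < ?f y"
  proof (rule DERIV_pos_imp_increasing_open[where f = "?f" and a = x and b = y])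
    fix s assume s: "x < s" "s < y"
    let ?D = "(1 + \<beta>) * ((s - c) powr \<beta> - (s - d) powr \<beta>) / (d - c)
              - (1 + \<beta>) * ((s - a) powr \<beta> - (s - b) powr \<beta>) / (b - a)"
    have "((s - a) powr \<beta> - (s - b) powr \<beta>) / ((s - a) - (s - b))
        < ((s - c) powr \<beta> - (s - d) powr \<beta>) / ((s - c) - (s - d))"
      using s assms by (intro powr_slope_strict_antimono) auto
    then have "(1 + \<beta>) * (((s - a) powr \<beta> - (s - b) powr \<beta>) / (b - a))
        < (1 + \<beta>) * (((s - c) powr \<beta> - (s - d) powr \<beta>) / (d - c))"
      using assms by (intro mult_strict_left_mono) auto
    then have "0 < ?D" by simp
    moreover have "(?f has_real_derivative ?D) (at s)"
      using s assms by (intro DERIV_diff DERIV_cdivide DERIV_block) auto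
    ultimately show "\<exists>y. (?f has_real_derivative y) (at s) \<and> 0 < y" by blast
  next
    show "continuous_on {x..y} ?f"
      using assms
      by (intro continuous_on_diff continuous_on_divide continuous_on_block
          continuous_on_const) auto
  qed (use assms in auto)
  then show ?thesis by (simp add: block_def diff_divide_distrib)
qed

text \<open>
  The quotient \<open>((x' - s) / (x - s)) powr (\<beta> - 1)\<close> of kernels decreases in \<open>s\<close>.  With \<open>m\<close> its
  value at \<open>s = b\<close>, integration in \<open>s\<close> shows that passing from \<open>x\<close> to \<open>x'\<close> multiplies the
  increment over \<open>[a, b]\<close> by at least \<open>m\<close> and the one over \<open>[c, d]\<close> by at most \<open>m\<close>.
\<close>

lemma powr_increment_tp2:
  fixes \<beta> a b c d x x' :: real
  assumes "0 < \<beta>" "\<beta> < 1" "a < b" "b \<le> c" "c < d" "d \<le> x" "x < x'"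
  shows "((x - a) powr \<beta> - (x - b) powr \<beta>) * ((x' - c) powr \<beta> - (x' - d) powr \<beta>)
       \<le> ((x' - a) powr \<beta> - (x' - b) powr \<beta>) * ((x - c) powr \<beta> - (x - d) powr \<beta>)"
proof -
  define m where "m = ((x' - b) / (x - b)) powr (\<beta> - 1)"
  have m: "0 < m" unfolding m_def using assms by simp
  have kernel: "(x' - s) powr (\<beta> - 1) = ((x' - s) / (x - s)) powr (\<beta> - 1) * (x - s) powr (\<beta> - 1)"
    if "s < x" for s
    using that assms by (simp flip: powr_mult)
  let ?f = "\<lambda>s. m * (x - s) powr \<beta> - (x' - s) powr \<beta>"
  let ?D = "\<lambda>s. \<beta> * ((x' - s) powr (\<beta> - 1) - m * (x - s) powr (\<beta> - 1))"
  have der: "(?f has_real_derivative ?D s) (at s)" if "s < x" for s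
    using that assms by (auto intro!: derivative_eq_intros simp: algebra_simps)
  have cont: "continuous_on {u..v} ?f" if "v \<le> x" for u v
    using that assms by (auto intro!: continuous_intros continuous_on_powr')
  have "?f a \<le> ?f b"
  proof (rule DERIV_nonneg_imp_increasing_open[where f = "?f" and a = a and b = b])
    fix s assume s: "a < s" "s < b"
    have "(x' - s) / (x - s) \<le> (x' - b) / (x - b)"
    proof -
      have "0 \<le> (x' - x) * (b - s)" using s assms by (intro mult_nonneg_nonneg) auto
      then show ?thesis using s assms by (simp add: field_simps)
    qed
    then have "m \<le> ((x' - s) / (x - s)) powr (\<beta> - 1)"
      unfolding m_def using s assms by (intro powr_mono2') auto
    then have "m * (x - s) powr (\<beta> - 1) \<le> (x' - s) powr (\<beta> - 1)"
      using kernel[of s] s assms by (simp add: mult_right_mono)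
    then show "\<exists>y. (?f has_real_derivative y) (at s) \<and> 0 \<le> y"
      using der[of s] s assms by (intro exI[of _ "?D s"]) auto
  qed (use assms cont in auto)
  then have 1: "m * ((x - a) powr \<beta> - (x - b) powr \<beta>) \<le> (x' - a) powr \<beta> - (x' - b) powr \<beta>"
    by (simp add: algebra_simps)
  have "?f d \<le> ?f c"
  proof (rule DERIV_nonpos_imp_decreasing_open[where f = "?f" and a = c and b = d])
    fix s assume s: "c < s" "s < d"
    have "(x' - b) / (x - b) \<le> (x' - s) / (x - s)"
    proof -
      have "0 \<le> (x' - x) * (s - b)" using s assms by (intro mult_nonneg_nonneg) auto
      then show ?thesis using s assms by (simp add: field_simps)
    qed
    then have "((x' - s) / (x - s)) powr (\<beta> - 1) \<le> m"
      unfolding m_def using s assms by (intro powr_mono2') auto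
    then have "(x' - s) powr (\<beta> - 1) \<le> m * (x - s) powr (\<beta> - 1)"
      using kernel[of s] s assms by (simp add: mult_right_mono)
    then show "\<exists>y. (?f has_real_derivative y) (at s) \<and> y \<le> 0"
      using der[of s] s assms by (intro exI[of _ "?D s"]) (auto simp: mult_le_0_iff)
  qed (use assms cont in auto)
  then have 2: "(x' - c) powr \<beta> - (x' - d) powr \<beta> \<le> m * ((x - c) powr \<beta> - (x - d) powr \<beta>)"
    by (simp add: algebra_simps)
  have "(x - b) powr \<beta> \<le> (x - a) powr \<beta>" "(x - d) powr \<beta> \<le> (x - c) powr \<beta>"
    using assms by (auto intro!: powr_mono2)
  then have "((x - a) powr \<beta> - (x - b) powr \<beta>) * ((x' - c) powr \<beta> - (x' - d) powr \<beta>)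
     \<le> ((x - a) powr \<beta> - (x - b) powr \<beta>) * (m * ((x - c) powr \<beta> - (x - d) powr \<beta>))"
    using 2 by (intro mult_left_mono) auto
  also have "\<dots> = (m * ((x - a) powr \<beta> - (x - b) powr \<beta>)) * ((x - c) powr \<beta> - (x - d) powr \<beta>)"
    by simp
  also have "\<dots> \<le> ((x' - a) powr \<beta> - (x' - b) powr \<beta>) * ((x - c) powr \<beta> - (x - d) powr \<beta>)"
    using 1 \<open>(x - d) powr \<beta> \<le> (x - c) powr \<beta>\<close> by (intro mult_right_mono) auto
  finally show ?thesis .
qed

text \<open>
  The second integration: by \<open>powr_increment_tp2\<close> the quotient of the integrands for
  \<open>[a, b]\<close> and \<open>[c, d]\<close> increases with the second variable, so its value \<open>q\<close> at \<open>y\<close> bounds it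
  from below on \<open>[y, z]\<close> and from above on \<open>[x, y]\<close>.
\<close>

lemma block_tp2:
  assumes "0 < \<beta>" "\<beta> < 1" "a < b" "b \<le> c" "c < d" "d \<le> x" "x < y" "y < z"
  shows "block \<beta> c d y z * block \<beta> a b x y \<le> block \<beta> a b y z * block \<beta> c d x y"
proof -
  define g where "g a b s = (s - a) powr \<beta> - (s - b) powr \<beta>" for a b s
  define H where "H a b s = (s - a) powr (1 + \<beta>) - (s - b) powr (1 + \<beta>)" for a b s
  have gpos: "0 < g u v s" if "u < v" "v \<le> s" for u v s
    unfolding g_def using that assms by (auto intro!: powr_less_mono2)
  \<comment> \<open>The quotient of the two integrands at the common end point \<open>y\<close>.\<close>
  define q where "q = g a b y / g c d y"
  have q: "q * g c d y = g a b y" using gpos[of c d y] assms by (simp add: q_def)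
  let ?f = "\<lambda>s. H a b s - q * H c d s"
  have der: "(?f has_real_derivative (1 + \<beta>) * (g a b s - q * g c d s)) (at s)" if "d < s" for s
  proof -
    have "(?f has_real_derivative (1 + \<beta>) * g a b s - q * ((1 + \<beta>) * g c d s)) (at s)"
      unfolding H_def g_def using that assms by (intro DERIV_diff DERIV_cmult DERIV_block) auto
    then show ?thesis by (simp add: algebra_simps)
  qed
  have cont: "continuous_on {u..v} ?f" if "d \<le> u" for u v
    unfolding H_def using that assms
    by (intro continuous_on_diff[OF continuous_on_block
          continuous_on_mult[OF continuous_on_const continuous_on_block]]) auto
  have "?f y \<le> ?f z"
  proof (rule DERIV_nonneg_imp_increasing_open[where f = "?f" and a = y and b = z])
    fix s assume s: "y < s" "s < z"
    have "g a b y * g c d s \<le> g a b s * g c d y"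
      unfolding g_def using s assms by (intro powr_increment_tp2) auto
    then have "(q * g c d s) * g c d y \<le> g a b s * g c d y"
      by (metis q mult.commute mult.left_commute)
    then have "q * g c d s \<le> g a b s" using gpos[of c d y] assms by simp
    then show "\<exists>y. (?f has_real_derivative y) (at s) \<and> 0 \<le> y"
      using der[of s] s assms by (intro exI[of _ "(1 + \<beta>) * (g a b s - q * g c d s)"]) auto
  qed (use assms cont in auto)
  then have 1: "q * block \<beta> c d y z \<le> block \<beta> a b y z"
    by (simp add: H_def block_def algebra_simps)
  have "?f y \<le> ?f x"
  proof (rule DERIV_nonpos_imp_decreasing_open[where f = "?f" and a = x and b = y])
    fix s assume s: "x < s" "s < y"
    have "g a b s * g c d y \<le> g a b y * g c d s"
      unfolding g_def using s assms by (intro powr_increment_tp2) auto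
    then have "g a b s * g c d y \<le> (q * g c d s) * g c d y"
      by (metis q mult.commute mult.left_commute)
    then have "g a b s \<le> q * g c d s" using gpos[of c d y] assms by simp
    then show "\<exists>y. (?f has_real_derivative y) (at s) \<and> y \<le> 0"
      using der[of s] s assms
      by (intro exI[of _ "(1 + \<beta>) * (g a b s - q * g c d s)"]) (auto simp: mult_le_0_iff)
  qed (use assms cont in auto)
  then have 2: "block \<beta> a b x y \<le> q * block \<beta> c d x y"
    by (simp add: H_def block_def algebra_simps)
  have "block \<beta> c d y z * block \<beta> a b x y \<le> block \<beta> c d y z * (q * block \<beta> c d x y)"
    using 2 block_pos[of \<beta> c d y z] assms by (intro mult_left_mono) auto
  also have "\<dots> = (q * block \<beta> c d y z) * block \<beta> c d x y" by simp
  also have "\<dots> \<le> block \<beta> a b y z * block \<beta> c d x y"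
    using 1 block_pos[of \<beta> c d x y] assms by (intro mult_right_mono) auto
  finally show ?thesis .
qed

text \<open>
  The inequality \<open>rho_product_le\<close> after rescaling the middle cell to length \<open>1\<close>.
\<close>

lemma block_near_diagonal:
  assumes "0 < \<beta>" "\<beta> < 1" "a < b" "b < c" "c < d"
    and "r_star \<beta> ((c - b) / (b - a)) \<le> (d - c) / (c - b)"
  shows "block \<beta> b c c d * block \<beta> a b b c \<le> block \<beta> a b c d * (2 * (c - b) powr (1 + \<beta>))"
proof -
  define \<tau> where "\<tau> = c - b"
  define x where "x = (b - a) / (c - b)"
  define y where "y = (d - c) / (c - b)"
  have pos: "0 < \<tau>" "0 < x" "0 < y" using assms by (auto simp: \<tau>_def x_def y_def)
  have ab: "b - a = \<tau> * x" and cd: "d - c = \<tau> * y" and bc: "c - b = \<tau>"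
    using assms by (auto simp: \<tau>_def x_def y_def)
  have "d - b = \<tau> * (y + 1)" "c - a = \<tau> * (x + 1)" "d - a = \<tau> * (1 + x + y)"
    using ab cd bc by (auto simp: algebra_simps)
  then have powrs:
    "(d - b) powr (1 + \<beta>) = \<tau> powr (1 + \<beta>) * (y + 1) powr (1 + \<beta>)"
    "(c - a) powr (1 + \<beta>) = \<tau> powr (1 + \<beta>) * (x + 1) powr (1 + \<beta>)"
    "(d - a) powr (1 + \<beta>) = \<tau> powr (1 + \<beta>) * (1 + x + y) powr (1 + \<beta>)"
    "(b - a) powr (1 + \<beta>) = \<tau> powr (1 + \<beta>) * x powr (1 + \<beta>)"
    "(d - c) powr (1 + \<beta>) = \<tau> powr (1 + \<beta>) * y powr (1 + \<beta>)"
    "(c - b) powr (1 + \<beta>) = \<tau> powr (1 + \<beta>)"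
    using ab cd bc pos by (simp_all only: powr_mult)
  have "block \<beta> b c c d = \<tau> powr (1 + \<beta>) * rho \<beta> y"
    unfolding block_def powrs by (simp add: rho_def algebra_simps)
  moreover have "block \<beta> a b b c = \<tau> powr (1 + \<beta>) * rho \<beta> x"
    unfolding block_def powrs by (simp add: rho_def algebra_simps)
  moreover have "block \<beta> a b c d = \<tau> powr (1 + \<beta>) * far_block \<beta> x y"
    unfolding block_def powrs by (simp add: far_block_def algebra_simps)
  moreover have "rho \<beta> y * rho \<beta> x \<le> 2 * far_block \<beta> x y"
    using rho_product_le[of \<beta> "1 / x" y] assms pos by (simp add: x_def y_def)
  then have "\<tau> powr (1 + \<beta>) * \<tau> powr (1 + \<beta>) * (rho \<beta> y * rho \<beta> x)
      \<le> \<tau> powr (1 + \<beta>) * \<tau> powr (1 + \<beta>) * (2 * far_block \<beta> x y)"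
    by (intro mult_left_mono) auto
  ultimately show ?thesis unfolding bc by (simp add: mult_ac)
qed

section \<open>Closed form of the averaged kernels\<close>

text \<open>
  The integrand may be unbounded at \<open>s = x\<close>, but its primitive is continuous there.
\<close>

lemma omega_has_integral:
  assumes "0 < \<beta>" "l \<le> u" "u \<le> x"
  shows "((\<lambda>s. omega \<beta> (x - s)) has_integral
      ((x - l) powr \<beta> - (x - u) powr \<beta>) / (\<beta> * Gamma \<beta>)) {l..u}"
proof -
  have G: "Gamma \<beta> \<noteq> 0" using Gamma_real_pos[OF assms(1)] by linarith
  have "((\<lambda>s. omega \<beta> (x - s)) has_integral
     (\<lambda>s. - ((x - s) powr \<beta>) / (\<beta> * Gamma \<beta>)) u
     - (\<lambda>s. - ((x - s) powr \<beta>) / (\<beta> * Gamma \<beta>)) l) {l..u}"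
  proof (rule fundamental_theorem_of_calculus_interior)
    show "continuous_on {l..u} (\<lambda>s. - ((x - s) powr \<beta>) / (\<beta> * Gamma \<beta>))"
      using assms G by (auto intro!: continuous_intros continuous_on_powr')
    fix s assume "s \<in> {l<..<u}"
    then have "((\<lambda>s. - ((x - s) powr \<beta>) / (\<beta> * Gamma \<beta>))
        has_real_derivative omega \<beta> (x - s)) (at s)"
      using assms G by (auto intro!: derivative_eq_intros simp: omega_def)
    then show "((\<lambda>s. - ((x - s) powr \<beta>) / (\<beta> * Gamma \<beta>))
        has_vector_derivative omega \<beta> (x - s)) (at s)"
      by (simp add: has_real_derivative_iff_has_vector_derivative)
  qed (use assms in auto)
  then show ?thesis by (simp add: diff_divide_distrib)
qed

lemma powr_shift_has_integral:
  fixes \<beta> a x y :: real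
  assumes "0 < \<beta>" "a \<le> x" "x \<le> y"
  shows "((\<lambda>s. (s - a) powr \<beta>) has_integral
      ((y - a) powr (1 + \<beta>) - (x - a) powr (1 + \<beta>)) / (1 + \<beta>)) {x..y}"
proof -
  have "((\<lambda>s. (s - a) powr \<beta>) has_integral
     (\<lambda>s. (s - a) powr (1 + \<beta>) / (1 + \<beta>)) y - (\<lambda>s. (s - a) powr (1 + \<beta>) / (1 + \<beta>)) x) {x..y}"
  proof (rule fundamental_theorem_of_calculus_interior
      [where f = "\<lambda>s::real. (s - a) powr (1 + \<beta>) / (1 + \<beta>)"])
    show "continuous_on {x..y} (\<lambda>s. (s - a) powr (1 + \<beta>) / (1 + \<beta>))"
      using assms by (auto intro!: continuous_intros continuous_on_powr')
    fix s assume "s \<in> {x<..<y}"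
    then have "((\<lambda>s. (s - a) powr (1 + \<beta>) / (1 + \<beta>)) has_real_derivative (s - a) powr \<beta>) (at s)"
      using assms by (auto intro!: derivative_eq_intros)
    then show "((\<lambda>s. (s - a) powr (1 + \<beta>) / (1 + \<beta>)) has_vector_derivative (s - a) powr \<beta>) (at s)"
      by (simp add: has_real_derivative_iff_has_vector_derivative)
  qed (use assms in auto)
  then show ?thesis by (simp add: diff_divide_distrib)
qed

text \<open>
  By the functional equation of the Gamma function this is \<open>1 / Gamma (\<beta> + 2)\<close>.
\<close>

definition kernel_const :: "real \<Rightarrow> real" where
  "kernel_const \<beta> = 1 / (Gamma \<beta> * \<beta> * (1 + \<beta>))"

lemma avg_kernel_diag:
  assumes "0 < \<beta>" "t (n - 1) < t n"
  shows "avg_kernel \<beta> t n n =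
    kernel_const \<beta> * (t n - t (n - 1)) powr (1 + \<beta>) / (step_size t n * step_size t n)"
proof -
  have "integral {t (n - 1)..t n} (\<lambda>x. integral {t (n - 1)..min x (t n)} (\<lambda>s. omega \<beta> (x - s)))
    = integral {t (n - 1)..t n} (\<lambda>x. 1 / (\<beta> * Gamma \<beta>) * (x - t (n - 1)) powr \<beta>)"
    using assms
    by (intro integral_cong) (auto
        intro!: integral_unique[OF has_integral_eq_rhs[OF omega_has_integral]])
  also have "\<dots> = 1 / (\<beta> * Gamma \<beta>) * ((t n - t (n - 1)) powr (1 + \<beta>) / (1 + \<beta>))"
    using powr_shift_has_integral[of \<beta> "t (n - 1)" "t (n - 1)" "t n"] assms
    by (intro integral_unique has_integral_mult_right) auto
  finally show ?thesis by (simp add: avg_kernel_def kernel_const_def mult_ac)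
qed

lemma avg_kernel_off_diag:
  assumes "0 < \<beta>" "t (k - 1) < t k" "t k \<le> t (n - 1)" "t (n - 1) < t n"
  shows "avg_kernel \<beta> t n k =
    kernel_const \<beta> * block \<beta> (t (k - 1)) (t k) (t (n - 1)) (t n) / (step_size t n * step_size t k)"
proof -
  have "integral {t (n - 1)..t n} (\<lambda>x. integral {t (k - 1)..min x (t k)} (\<lambda>s. omega \<beta> (x - s)))
    = integral {t (n - 1)..t n}
        (\<lambda>x. 1 / (\<beta> * Gamma \<beta>) * ((x - t (k - 1)) powr \<beta> - (x - t k) powr \<beta>))"
    using assms
    by (intro integral_cong) (auto simp: min_def
        intro!: integral_unique[OF has_integral_eq_rhs[OF omega_has_integral]])
  also have "\<dots> = 1 / (\<beta> * Gamma \<beta>) *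
     (((t n - t (k - 1)) powr (1 + \<beta>) - (t (n - 1) - t (k - 1)) powr (1 + \<beta>)) / (1 + \<beta>)
      - ((t n - t k) powr (1 + \<beta>) - (t (n - 1) - t k) powr (1 + \<beta>)) / (1 + \<beta>))"
    using assms
    by (intro integral_unique has_integral_mult_right has_integral_diff
        powr_shift_has_integral) auto
  also have "\<dots> = kernel_const \<beta> * block \<beta> (t (k - 1)) (t k) (t (n - 1)) (t n)"
    using assms Gamma_real_pos[of \<beta>] by (simp add: kernel_const_def block_def divide_simps)
  finally show ?thesis by (simp add: avg_kernel_def mult_ac)
qed

section \<open>The modified kernels on a mesh with bounded step ratios\<close>

locale mesh =
  fixes \<beta> :: real and t :: "nat \<Rightarrow> real" and N :: nat
  assumes \<beta>: "0 < \<beta>" "\<beta> < 1"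
    and increasing: "\<And>k. 1 \<le> k \<Longrightarrow> k \<le> N \<Longrightarrow> t (k - 1) < t k"
    and ratios: "\<And>k. 2 \<le> k \<Longrightarrow> k < N \<Longrightarrow> r_star \<beta> (step_ratio t k) \<le> step_ratio t (k + 1)"
begin

abbreviation A :: "nat \<Rightarrow> nat \<Rightarrow> real" where "A \<equiv> mod_kernel \<beta> t"

lemma nodes_less: "i < j \<Longrightarrow> j \<le> N \<Longrightarrow> t i < t j"
proof (induction j)
  case (Suc j)
  then show ?case using increasing[of "Suc j"] by (cases "i = j") auto
qed simp

lemma nodes_le: "i \<le> j \<Longrightarrow> j \<le> N \<Longrightarrow> t i \<le> t j"
  using nodes_less[of i j] by (cases "i = j") auto

lemma step_pos: "1 \<le> k \<Longrightarrow> k \<le> N \<Longrightarrow> 0 < step_size t k"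
  using increasing[of k] by (simp add: step_size_def)

lemma kernel_const_pos: "0 < kernel_const \<beta>"
  using \<beta> Gamma_real_pos[of \<beta>] by (simp add: kernel_const_def)

lemma kernel_diag:
  assumes "1 \<le> n" "n \<le> N"
  shows "A n n =
    kernel_const \<beta> * (2 * step_size t n powr (1 + \<beta>)) / (step_size t n * step_size t n)"
  using avg_kernel_diag[of \<beta> t n] assms increasing[of n] \<beta>
  by (simp add: mod_kernel_def step_size_def)

lemma kernel_off_diag:
  assumes "1 \<le> k" "k < n" "n \<le> N"
  shows "A n k =
    kernel_const \<beta> * block \<beta> (t (k - 1)) (t k) (t (n - 1)) (t n) / (step_size t n * step_size t k)"
  using avg_kernel_off_diag[of \<beta> t k n] assms increasing[of k] increasing[of n]
    nodes_le[of k "n - 1"] \<beta>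
  by (simp add: mod_kernel_def)

lemma kernel_pos:
  assumes "1 \<le> k" "k \<le> n" "n \<le> N"
  shows "0 < A n k"
proof (cases "k = n")
  case True
  then show ?thesis using kernel_diag[of n] step_pos[of n] kernel_const_pos assms by simp
next
  case False
  then have "0 < block \<beta> (t (k - 1)) (t k) (t (n - 1)) (t n)"
    using assms \<beta> by (intro block_pos nodes_less nodes_le) auto
  then show ?thesis
    using False kernel_off_diag[of k n] step_pos[of n] step_pos[of k] kernel_const_pos assms
    by simp
qed

text \<open>
  The doubled diagonal entry is the average of \<open>\<bar>v - u\<bar> powr (\<beta> - 1)\<close> over the full square, up
  to the factor common to all kernels.  Doubling is what makes it exceed its neighbours
  for every step ratio.
\<close>

lemma subdiagonal_less:
  assumes "2 \<le> n" "n \<le> N"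
  shows "A n (n - 1) < A n n" "A n (n - 1) < A (n - 1) (n - 1)"
proof -
  define \<tau> \<sigma> where "\<tau> = step_size t n" and "\<sigma> = step_size t (n - 1)"
  have pos: "0 < \<tau>" "0 < \<sigma>" using step_pos assms by (auto simp: \<tau>_def \<sigma>_def)
  have pw: "x powr (1 + \<beta>) = x * x powr \<beta>" if "0 < x" for x
    using that by (simp add: powr_add)
  define B where "B = (\<tau> + \<sigma>) powr (1 + \<beta>) - \<tau> powr (1 + \<beta>) - \<sigma> powr (1 + \<beta>)"
  have "t n - t (n - 1 - 1) = \<tau> + \<sigma>" by (simp add: \<tau>_def \<sigma>_def step_size_def)
  then have "block \<beta> (t (n - 1 - 1)) (t (n - 1)) (t (n - 1)) (t n) = B"
    using \<beta> by (simp add: block_def B_def \<tau>_def \<sigma>_def step_size_def)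
  then have A: "A n (n - 1) = kernel_const \<beta> * B / (\<tau> * \<sigma>)"
    using kernel_off_diag[of "n - 1" n] assms by (simp add: \<tau>_def \<sigma>_def)
  have "B < 2 * \<sigma> * \<tau> powr \<beta>" "B < 2 * \<tau> * \<sigma> powr \<beta>"
    using adjacent_block_bound[of \<beta> \<sigma> \<tau>] adjacent_block_bound[of \<beta> \<tau> \<sigma>] pos \<beta>
    by (auto simp: B_def add.commute)
  then have "B / (\<tau> * \<sigma>) < 2 * \<tau> powr (1 + \<beta>) / (\<tau> * \<tau>)"
    "B / (\<tau> * \<sigma>) < 2 * \<sigma> powr (1 + \<beta>) / (\<sigma> * \<sigma>)"
    using pos by (simp_all add: pw divide_simps mult_ac)
  then have "kernel_const \<beta> * (B / (\<tau> * \<sigma>)) < kernel_const \<beta> * (2 * \<tau> powr (1 + \<beta>) / (\<tau> * \<tau>))"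
    "kernel_const \<beta> * (B / (\<tau> * \<sigma>)) < kernel_const \<beta> * (2 * \<sigma> powr (1 + \<beta>) / (\<sigma> * \<sigma>))"
    using kernel_const_pos by (simp_all only: mult_less_cancel_left_pos)
  then show "A n (n - 1) < A n n" "A n (n - 1) < A (n - 1) (n - 1)"
    using A kernel_diag[of n] kernel_diag[of "n - 1"] assms by (simp_all add: \<tau>_def \<sigma>_def)
qed

lemma row_mono_off_diag:
  assumes "1 \<le> k" "k < j" "j < n" "n \<le> N"
  shows "A n k < A n j"
proof -
  have "block \<beta> (t (k - 1)) (t k) (t (n - 1)) (t n) / (t k - t (k - 1))
      < block \<beta> (t (j - 1)) (t j) (t (n - 1)) (t n) / (t j - t (j - 1))"
    using assms \<beta> by (intro block_row_mono nodes_less nodes_le) auto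
  then have
    "kernel_const \<beta> / step_size t n *
        (block \<beta> (t (k - 1)) (t k) (t (n - 1)) (t n) / step_size t k)
      < kernel_const \<beta> / step_size t n *
        (block \<beta> (t (j - 1)) (t j) (t (n - 1)) (t n) / step_size t j)"
    using kernel_const_pos step_pos[of n] assms
    by (intro mult_strict_left_mono) (auto simp: step_size_def)
  then show ?thesis using kernel_off_diag[of k n] kernel_off_diag[of j n] assms by simp
qed

lemma row_mono:
  assumes "1 \<le> k" "k < j" "j \<le> n" "n \<le> N"
  shows "A n k < A n j"
proof (cases "j = n")
  case True
  have "A n k \<le> A n (n - 1)"
  proof (cases "k = n - 1")
    case False
    then have "k < n - 1" using assms True by linarith
    then show ?thesis using row_mono_off_diag[of k "n - 1" n] assms True by simp
  qed simp
  then show ?thesis using subdiagonal_less(1)[of n] assms True by simp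
next
  case False
  then show ?thesis using row_mono_off_diag assms by simp
qed

lemma column_antimono_off_diag:
  assumes "1 \<le> k" "k < j" "j < n" "n \<le> N"
  shows "A n k < A j k"
proof -
  have "block \<beta> (t (k - 1)) (t k) (t (n - 1)) (t n) / (t n - t (n - 1))
      < block \<beta> (t (k - 1)) (t k) (t (j - 1)) (t j) / (t j - t (j - 1))"
    using assms \<beta> by (intro block_column_antimono nodes_less nodes_le) auto
  then have
    "kernel_const \<beta> / step_size t k *
        (block \<beta> (t (k - 1)) (t k) (t (n - 1)) (t n) / step_size t n)
      < kernel_const \<beta> / step_size t k *
        (block \<beta> (t (k - 1)) (t k) (t (j - 1)) (t j) / step_size t j)"
    using kernel_const_pos step_pos[of k] assms
    by (intro mult_strict_left_mono) (auto simp: step_size_def)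
  then show ?thesis
    using kernel_off_diag[of k n] kernel_off_diag[of k j] assms by (simp add: mult.commute)
qed

lemma column_antimono:
  assumes "1 \<le> k" "k \<le> j" "j < n" "n \<le> N"
  shows "A n k < A j k"
proof (cases "j = k")
  case True
  have "A n k \<le> A (k + 1) k"
    using column_antimono_off_diag[of k "k + 1" n] assms True by (cases "n = k + 1") auto
  then show ?thesis using subdiagonal_less(2)[of "k + 1"] assms True by simp
next
  case False
  then show ?thesis using column_antimono_off_diag assms by simp
qed

lemma cross_off_diag:
  assumes "1 \<le> k" "k < j" "j < n - 1" "n \<le> N"
  shows "A n j * A (n - 1) k \<le> A n k * A (n - 1) j"
proof -
  have
    "block \<beta> (t (j - 1)) (t j) (t (n - 1)) (t n)
        * block \<beta> (t (k - 1)) (t k) (t (n - 1 - 1)) (t (n - 1))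
     \<le> block \<beta> (t (k - 1)) (t k) (t (n - 1)) (t n)
        * block \<beta> (t (j - 1)) (t j) (t (n - 1 - 1)) (t (n - 1))"
    using assms \<beta> by (intro block_tp2 nodes_less nodes_le) auto
  moreover have "1 \<le> j" "k < n" "j < n" "k < n - 1" "n - 1 \<le> N" using assms by auto
  moreover define c where "c = kernel_const \<beta> * kernel_const \<beta> /
      (step_size t n * step_size t j * step_size t (n - 1) * step_size t k)"
  moreover have "0 < step_size t n" "0 < step_size t j" "0 < step_size t (n - 1)"
    "0 < step_size t k"
    using assms by (auto intro!: step_pos)
  then have "0 \<le> c" using kernel_const_pos by (simp add: c_def)
  ultimately have
    "c * (block \<beta> (t (j - 1)) (t j) (t (n - 1)) (t n)
        * block \<beta> (t (k - 1)) (t k) (t (n - 1 - 1)) (t (n - 1)))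
     \<le> c * (block \<beta> (t (k - 1)) (t k) (t (n - 1)) (t n)
        * block \<beta> (t (j - 1)) (t j) (t (n - 1 - 1)) (t (n - 1)))"
    by (intro mult_left_mono) auto
  then show ?thesis
    using kernel_off_diag[of k n] kernel_off_diag[of j n] kernel_off_diag[of k "n - 1"]
      kernel_off_diag[of j "n - 1"] assms(1,4) \<open>1 \<le> j\<close> \<open>k < n\<close> \<open>j < n\<close>
      \<open>k < n - 1\<close> \<open>j < n - 1\<close> \<open>n - 1 \<le> N\<close>
    by (simp add: c_def mult_ac)
qed

text \<open>
  The instance of \<open>cross\<close> in which a diagonal entry occurs, and where \<open>ratios\<close> enters.  The
  index shift \<open>n = m + 3\<close> avoids truncated subtraction.
\<close>

lemma cross_at_diag:
  assumes "3 \<le> n" "n \<le> N"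
  shows "A n (n - 1) * A (n - 1) (n - 2) \<le> A n (n - 2) * A (n - 1) (n - 1)"
proof -
  obtain m where n: "n = m + 3" using assms by (metis add.commute le_Suc_ex)
  have r: "r_star \<beta> ((t (m + 2) - t (m + 1)) / (t (m + 1) - t m))
      \<le> (t (m + 3) - t (m + 2)) / (t (m + 2) - t (m + 1))"
    using ratios[of "m + 2"] assms n by (simp add: step_ratio_def step_size_def numeral_eq_Suc)
  have
    "block \<beta> (t (m + 1)) (t (m + 2)) (t (m + 2)) (t (m + 3))
        * block \<beta> (t m) (t (m + 1)) (t (m + 1)) (t (m + 2))
     \<le> block \<beta> (t m) (t (m + 1)) (t (m + 2)) (t (m + 3))
        * (2 * (t (m + 2) - t (m + 1)) powr (1 + \<beta>))"
    using assms \<beta> r n by (intro block_near_diagonal nodes_less) auto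
  moreover define c where "c = kernel_const \<beta> * kernel_const \<beta> /
      (step_size t (m + 3) * step_size t (m + 2) * step_size t (m + 2) * step_size t (m + 1))"
  moreover have "0 \<le> c"
    using step_pos[of "m + 3"] step_pos[of "m + 2"] step_pos[of "m + 1"] kernel_const_pos assms n
    by (simp add: c_def)
  ultimately have
    "c * (block \<beta> (t (m + 1)) (t (m + 2)) (t (m + 2)) (t (m + 3))
        * block \<beta> (t m) (t (m + 1)) (t (m + 1)) (t (m + 2)))
     \<le> c * (block \<beta> (t m) (t (m + 1)) (t (m + 2)) (t (m + 3))
        * (2 * (t (m + 2) - t (m + 1)) powr (1 + \<beta>)))"
    by (intro mult_left_mono) auto
  moreover have "A (m + 3) (m + 2) =
      kernel_const \<beta> * block \<beta> (t (m + 1)) (t (m + 2)) (t (m + 2)) (t (m + 3))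
      / (step_size t (m + 3) * step_size t (m + 2))"
    using kernel_off_diag[of "m + 2" "m + 3"] assms n by (simp add: numeral_eq_Suc)
  moreover have "A (m + 2) (m + 1) =
      kernel_const \<beta> * block \<beta> (t m) (t (m + 1)) (t (m + 1)) (t (m + 2))
      / (step_size t (m + 2) * step_size t (m + 1))"
    using kernel_off_diag[of "m + 1" "m + 2"] assms n by (simp add: numeral_eq_Suc)
  moreover have "A (m + 3) (m + 1) =
      kernel_const \<beta> * block \<beta> (t m) (t (m + 1)) (t (m + 2)) (t (m + 3))
      / (step_size t (m + 3) * step_size t (m + 1))"
    using kernel_off_diag[of "m + 1" "m + 3"] assms n by (simp add: numeral_eq_Suc)
  moreover have "A (m + 2) (m + 2) =
      kernel_const \<beta> * (2 * (t (m + 2) - t (m + 1)) powr (1 + \<beta>))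
      / (step_size t (m + 2) * step_size t (m + 2))"
    using kernel_diag[of "m + 2"] assms n by (simp add: step_size_def numeral_eq_Suc)
  ultimately have "A (m + 3) (m + 2) * A (m + 2) (m + 1) \<le> A (m + 3) (m + 1) * A (m + 2) (m + 2)"
    by (simp add: c_def mult_ac)
  moreover have "n - 1 = m + 2" "n - 2 = m + 1" using n by auto
  ultimately show ?thesis unfolding n by simp
qed

text \<open>
  Consecutive columns suffice: the comparison of column \<open>n - 1\<close> with an earlier column passes
  through column \<open>n - 2\<close>.
\<close>

lemma cross:
  assumes "1 \<le> k" "k < j" "j < n" "n \<le> N"
  shows "A n j * A (n - 1) k \<le> A n k * A (n - 1) j"
proof (cases "j = n - 1")
  case False
  then show ?thesis using cross_off_diag assms by simp
next
  case True
  have diag: "A n (n - 1) * A (n - 1) (n - 2) \<le> A n (n - 2) * A (n - 1) (n - 1)"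
    using cross_at_diag assms True by simp
  show ?thesis
  proof (cases "k = n - 2")
    case True
    then show ?thesis using diag \<open>j = n - 1\<close> by simp
  next
    case False
    have off: "A n (n - 2) * A (n - 1) k \<le> A n k * A (n - 1) (n - 2)"
      using cross_off_diag[of k "n - 2" n] False assms True by simp
    have pos: "0 < A (n - 1) k" "0 < A (n - 1) (n - 2)" "0 < A (n - 1) (n - 1)"
      using assms True by (auto intro!: kernel_pos)
    have "A (n - 1) (n - 2) * (A n (n - 1) * A (n - 1) k)
        = (A n (n - 1) * A (n - 1) (n - 2)) * A (n - 1) k"
      by simp
    also have "\<dots> \<le> (A n (n - 2) * A (n - 1) (n - 1)) * A (n - 1) k"
      using diag pos by (intro mult_right_mono) auto
    also have "\<dots> = (A n (n - 2) * A (n - 1) k) * A (n - 1) (n - 1)" by simp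
    also have "\<dots> \<le> (A n k * A (n - 1) (n - 2)) * A (n - 1) (n - 1)"
      using off pos by (intro mult_right_mono) auto
    also have "\<dots> = A (n - 1) (n - 2) * (A n k * A (n - 1) (n - 1))" by simp
    finally show ?thesis using pos True by simp
  qed
qed

lemma doc_nonpos:
  assumes "1 \<le> k" "k < n" "n \<le> N"
  shows "doc A n k \<le> 0"
  using doc_offdiag_nonpos[of N A k n] kernel_pos cross assms by blast

lemma dcc_kernel_pos:
  assumes "1 \<le> k" "k \<le> n" "n \<le> N"
  shows "0 < dcc A n k"
  using dcc_pos[of N A k n] kernel_pos row_mono doc_nonpos assms by blast

lemma rcc_kernel_pos:
  assumes "1 \<le> k" "k \<le> n" "n \<le> N"
  shows "0 < rcc A n k"
  using rcc_pos[of N A k n] kernel_pos column_antimono doc_nonpos assms by blast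

context
  fixes w v :: "nat \<Rightarrow> real"
  assumes v0: "v 0 = 0" and v: "\<And>j. 1 \<le> j \<Longrightarrow> j \<le> N \<Longrightarrow> v j = (\<Sum>l=1..j. A j l * w l)"
begin

lemma energy_identity:
  assumes "1 \<le> n" "n \<le> N"
  shows "2 * w n * (\<Sum>j=1..n. avg_kernel \<beta> t n j * w j) =
     (\<Sum>j=1..n. dcc A n j * (v j)\<^sup>2) - (\<Sum>j=1..n-1. dcc A (n - 1) j * (v j)\<^sup>2)
     + (\<Sum>j=1..n-1. (1 / rcc A n j - 1 / rcc A n (j + 1)) *
          (\<Sum>k=1..j. rcc A n k * (v k - v (k - 1)))\<^sup>2)"
proof -
  have ins: "{1..n} = insert n {1..n-1}" using assms by auto
  have "(\<Sum>j=1..n-1. avg_kernel \<beta> t n j * w j) = (\<Sum>j=1..n-1. A n j * w j)"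
    using assms by (intro sum.cong) (auto simp: mod_kernel_def)
  moreover have "avg_kernel \<beta> t n n = A n n / 2" by (simp add: mod_kernel_def)
  ultimately have "(\<Sum>j=1..n. avg_kernel \<beta> t n j * w j) = v n - A n n / 2 * w n"
    unfolding v[OF assms] ins using assms by simp
  moreover have "A i i \<noteq> 0" "rcc A n i \<noteq> 0" if "1 \<le> i" "i \<le> n" for i
    using kernel_pos[of i i] rcc_kernel_pos[of i n] that assms by auto
  ultimately show ?thesis
    using gradient_structure[where a = A and v = v and w = w, OF assms(1)] v v0 assms by simp
qed

text \<open>
  Sum the energy identity over the levels.  The quadratic terms are nonnegative since
  \<open>rcc A n\<close> increases in its column, by the sign of the orthogonal kernels.
\<close>

lemma energy_bound:
  assumes "n \<le> N"
  shows "(\<Sum>k=1..n. dcc A n k * (v k)\<^sup>2)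
       \<le> 2 * (\<Sum>k=1..n. w k * (\<Sum>j=1..k. avg_kernel \<beta> t k j * w j))"
  using assms
proof (induction n)
  case (Suc n)
  have "0 \<le> (1 / rcc A (Suc n) j - 1 / rcc A (Suc n) (j + 1))" if "j \<in> {1..n}" for j
  proof -
    have "rcc A (Suc n) j \<le> rcc A (Suc n) (j + 1)"
      using rcc_step[of j "Suc n" A] doc_nonpos[of j "Suc n"] that Suc.prems by simp
    then show ?thesis using rcc_kernel_pos[of j "Suc n"] that Suc.prems by (simp add: frac_le)
  qed
  then have "0 \<le> (\<Sum>j=1..n. (1 / rcc A (Suc n) j - 1 / rcc A (Suc n) (j + 1)) *
          (\<Sum>k=1..j. rcc A (Suc n) k * (v k - v (k - 1)))\<^sup>2)"
    by (intro sum_nonneg mult_nonneg_nonneg) auto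
  then have "(\<Sum>j=1..Suc n. dcc A (Suc n) j * (v j)\<^sup>2) - (\<Sum>j=1..n. dcc A n j * (v j)\<^sup>2)
      \<le> 2 * (w (Suc n) * (\<Sum>j=1..Suc n. avg_kernel \<beta> t (Suc n) j * w j))"
    using energy_identity[of "Suc n"] Suc.prems by (simp add: mult.assoc)
  moreover have "(\<Sum>k=1..n. dcc A n k * (v k)\<^sup>2)
       \<le> 2 * (\<Sum>k=1..n. w k * (\<Sum>j=1..k. avg_kernel \<beta> t k j * w j))"
    using Suc by simp
  ultimately show ?case
    unfolding sum.cl_ivl_Suc[of "\<lambda>k. w k * _ k"] by (simp add: distrib_left)
qed simp

text \<open>
  The data \<open>w\<close> are recovered from \<open>v\<close> by the inverse, so \<open>v\<close> cannot vanish identically.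
\<close>

lemma energy_pos:
  assumes "n \<le> N" "1 \<le> m" "m \<le> n" "w m \<noteq> 0"
  shows "0 < (\<Sum>k=1..n. dcc A n k * (v k)\<^sup>2)"
proof -
  have "(\<Sum>j=1..m. doc A m j * v j) = w m"
  proof (rule doc_solves)
    show "A i i \<noteq> 0" if "1 \<le> i" "i \<le> m" for i
      using kernel_pos[of i i] that assms by simp
  qed (use v assms in auto)
  then obtain j where j: "1 \<le> j" "j \<le> m" "v j \<noteq> 0"
    using \<open>w m \<noteq> 0\<close> by (metis (no_types, lifting) atLeastAtMost_iff mult_zero_right sum.neutral)
  show ?thesis
  proof (rule sum_pos2[of _ j])
    show "0 < dcc A n j * (v j)\<^sup>2" using dcc_kernel_pos[of j n] j assms by simp
    show "0 \<le> dcc A n i * (v i)\<^sup>2" if "i \<in> {1..n}" for i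
      using dcc_kernel_pos[of i n] that assms by (simp add: less_imp_le)
  qed (use j assms in auto)
qed

end

end

theorem theorem2p2:
  fixes \<beta> T :: real and N :: nat and t :: "nat \<Rightarrow> real"
  assumes "0 < \<beta>" and "\<beta> < 1"
    and "1 \<le> N"
    and "t 0 = 0" and "\<forall>k\<in>{1..N}. t (k - 1) < t k" and "t N = T"
    and "\<forall>k\<in>{2..N-1}. step_ratio t (k + 1) \<ge> r_star \<beta> (step_ratio t k)"
  shows
    "(\<forall>n\<in>{1..N}. \<forall>k\<in>{1..n}.
        dcc (mod_kernel \<beta> t) n k > 0 \<and> rcc (mod_kernel \<beta> t) n k > 0) \<and>
     (\<forall>w v :: nat \<Rightarrow> real.
        v 0 = 0 \<longrightarrow>
        (\<forall>j\<in>{1..N}. v j = (\<Sum>l=1..j. mod_kernel \<beta> t j l * w l)) \<longrightarrow>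
        (\<forall>n\<in>{1..N}.
           2 * w n * (\<Sum>j=1..n. avg_kernel \<beta> t n j * w j) =
             (\<Sum>j=1..n. dcc (mod_kernel \<beta> t) n j * (v j)\<^sup>2)
             - (\<Sum>j=1..n-1. dcc (mod_kernel \<beta> t) (n - 1) j * (v j)\<^sup>2)
             + (\<Sum>j=1..n-1.
                  (1 / rcc (mod_kernel \<beta> t) n j - 1 / rcc (mod_kernel \<beta> t) n (j + 1)) *
                  (\<Sum>k=1..j. rcc (mod_kernel \<beta> t) n k * (v k - v (k - 1)))\<^sup>2)) \<and>
        (\<forall>n\<in>{1..N}.
           (\<exists>k\<in>{1..n}. w k \<noteq> 0) \<longrightarrow>
           2 * (\<Sum>k=1..n. w k * (\<Sum>j=1..k. avg_kernel \<beta> t k j * w j))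
             \<ge> (\<Sum>k=1..n. dcc (mod_kernel \<beta> t) n k * (v k)\<^sup>2) \<and>
           (\<Sum>k=1..n. dcc (mod_kernel \<beta> t) n k * (v k)\<^sup>2) > 0))"
proof -
  interpret mesh \<beta> t N
    using assms by unfold_locales auto
  show ?thesis
  proof (intro conjI allI impI ballI)
    fix n k assume "n \<in> {1..N}" "k \<in> {1..n}"
    then show "dcc A n k > 0" "rcc A n k > 0"
      using dcc_kernel_pos rcc_kernel_pos by auto
  next
    fix w v :: "nat \<Rightarrow> real" and n
    assume v0: "v 0 = 0" and "\<forall>j\<in>{1..N}. v j = (\<Sum>l=1..j. A j l * w l)" and n: "n \<in> {1..N}"
    then have v: "v j = (\<Sum>l=1..j. A j l * w l)" if "1 \<le> j" "j \<le> N" for j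
      using that by auto
    show "2 * w n * (\<Sum>j=1..n. avg_kernel \<beta> t n j * w j) =
             (\<Sum>j=1..n. dcc A n j * (v j)\<^sup>2)
             - (\<Sum>j=1..n-1. dcc A (n - 1) j * (v j)\<^sup>2)
             + (\<Sum>j=1..n-1.
                  (1 / rcc A n j - 1 / rcc A n (j + 1)) *
                  (\<Sum>k=1..j. rcc A n k * (v k - v (k - 1)))\<^sup>2)"
      using energy_identity[where v = v and w = w, OF v0 v] n by auto
    show "2 * (\<Sum>k=1..n. w k * (\<Sum>j=1..k. avg_kernel \<beta> t k j * w j))
             \<ge> (\<Sum>k=1..n. dcc A n k * (v k)\<^sup>2)"
      using energy_bound[where v = v and w = w, OF v0 v] n by auto
    assume "\<exists>k\<in>{1..n}. w k \<noteq> 0"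
    then show "0 < (\<Sum>k=1..n. dcc A n k * (v k)\<^sup>2)"
      using energy_pos[where v = v and w = w, OF v0 v] n by auto
  qed
qed

end
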